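(* Let $\psi \in L^2(\mathbb{R})$ be a wavelet and let $\mathcal{F} = \{U^j\psi : 0 \le j < k\}$ be an interpolation family that admits operator interpolation; that is, $U \in \mathcal{C}_\psi(D,T)$ is a unitary operator all of whose powers lie in $\mathcal{C}_\psi(D,T)$, $U^k = I$ for some integer $k \ge 1$, and $U^*\{D,T\}'U = \{D,T\}'$. Let $\phi = V\psi$ be an operator interpolated wavelet, interpolated from $\mathcal{F}$; that is, $V = \sum_{j=1}^k A_j U^j$ is unitary, with $A_j \in \{D,T\}'$ for $1 \le j \le k$. Then $\phi$ is core equivalent to every wavelet in $\mathcal{F}$.
   Context: A function $\psi \in L^2(\mathbb{R})$ is a wavelet if $\{2^{j/2}\psi(2^j x + n) : j,n \in \mathbb{Z}\}$ is an orthonormal basis of $L^2(\mathbb{R})$. Define unitary operators on $L^2(\mathbb{R})$ by $Df(x) = \sqrt{2}\, f(2x)$ and $Tf(x) = f(x+1)$. The set $\{D,T\}'$ is the commutant of $\{D,T\}$ in $\mathcal{B}(L^2(\mathbb{R}))$. The local commutant at $\psi$ is $$\mathcal{C}_\psi(D,T) = \{V \in \mathcal{B}(L^2(\mathbb{R})) : V D^n T^l \psi = D^n T^l V \psi \text{ for all } n,l \in \mathbb{Z}\}.$$ If $V$ is a unitary in $\mathcal{C}_\psi(D,T)$ then $V\psi$ is a wavelet. An operator $V = \sum_{j=1}^k A_jU^j$ as in the claim lies in $\mathcal{C}_\psi(D,T)$, so when $V$ is unitary $V\psi$ is a wavelet, called an operator interpolated wavelet. The core space of a wavelet $\psi$ is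 $V_0^\psi = \overline{\mathrm{span}}\{D^n T^l \psi : n < 0,\ l \in \mathbb{Z}\}$. It is invariant under $T$ and $T^{-1}$, and the unitary representation $l \mapsto T^l|_{V_0^\psi}$ of $\mathbb{Z}$ is called the core representation of $\psi$. Two wavelets are core equivalent if their core representations are unitarily equivalent. *)

theory Defs
  imports "HOL-Analysis.Analysis"
begin

section \<open>The complex Hilbert space of square-integrable functions on the line\<close>

definition square_integrable :: "(real \<Rightarrow> complex) \<Rightarrow> bool" where
  "square_integrable f \<longleftrightarrow>
     f \<in> borel_measurable lborel \<and> integrable lborel (\<lambda>x. (cmod (f x))\<^sup>2)"

definition L2_rel :: "(real \<Rightarrow> complex) \<Rightarrow> (real \<Rightarrow> complex) \<Rightarrow> bool" where
  "L2_rel f g \<longleftrightarrow> square_integrable f \<and> square_integrable g \<and> (AE x in lborel. f x = g x)"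

lemma square_integrable_zero: "square_integrable (\<lambda>x. 0)"
  by (simp add: square_integrable_def)

lemma square_integrable_add:
  assumes "square_integrable f" "square_integrable g"
  shows "square_integrable (\<lambda>x. f x + g x)"
proof -
  have [measurable]: "f \<in> borel_measurable borel" "g \<in> borel_measurable borel"
    using assms by (auto simp: square_integrable_def)
  have "integrable lborel (\<lambda>x. (cmod (f x + g x))\<^sup>2)"
  proof (rule Bochner_Integration.integrable_bound)
    show "integrable lborel (\<lambda>x. 2 * (cmod (f x))\<^sup>2 + 2 * (cmod (g x))\<^sup>2)"
      using assms by (auto simp: square_integrable_def)
    have "(cmod (f x + g x))\<^sup>2 \<le> 2 * (cmod (f x))\<^sup>2 + 2 * (cmod (g x))\<^sup>2" for x
    proof -
      have "(cmod (f x + g x))\<^sup>2 \<le> (cmod (f x) + cmod (g x))\<^sup>2"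
        by (intro power_mono norm_triangle_ineq) auto
      also have "\<dots> \<le> 2 * (cmod (f x))\<^sup>2 + 2 * (cmod (g x))\<^sup>2"
        using zero_le_power2[of "cmod (f x) - cmod (g x)"]
        by (simp add: power2_sum power2_diff)
      finally show ?thesis .
    qed
    then show "AE x in lborel. norm ((cmod (f x + g x))\<^sup>2)
        \<le> norm (2 * (cmod (f x))\<^sup>2 + 2 * (cmod (g x))\<^sup>2)"
      by auto
  qed simp
  then show ?thesis by (simp add: square_integrable_def)
qed

lemma square_integrable_cmult:
  assumes "square_integrable f"
  shows "square_integrable (\<lambda>x. c * f x)"
  using assms by (auto simp: square_integrable_def norm_mult power_mult_distrib)

lemma square_integrable_affine:
  assumes "square_integrable f" "a \<noteq> 0"
  shows "square_integrable (\<lambda>x. f (a * x + b))"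
proof -
  have [measurable]: "f \<in> borel_measurable borel"
    using assms by (auto simp: square_integrable_def)
  have "integrable lborel (\<lambda>x. (cmod (f (b + a * x)))\<^sup>2)"
    using lborel_integrable_real_affine[of "\<lambda>x. (cmod (f x))\<^sup>2" a b] assms
    by (auto simp: square_integrable_def)
  then show ?thesis by (simp add: square_integrable_def add.commute)
qed

lemma integrable_mult_cnj:
  assumes "square_integrable f" "square_integrable g"
  shows "integrable lborel (\<lambda>x. f x * cnj (g x))"
proof (rule Bochner_Integration.integrable_bound)
  have [measurable]: "f \<in> borel_measurable borel" "g \<in> borel_measurable borel"
    using assms by (auto simp: square_integrable_def)
  have [measurable]: "cnj \<in> borel_measurable borel"
    by (intro borel_measurable_continuous_onI continuous_intros)
  show "integrable lborel (\<lambda>x. (cmod (f x))\<^sup>2 + (cmod (g x))\<^sup>2)"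
    using assms by (auto simp: square_integrable_def)
  show "(\<lambda>x. f x * cnj (g x)) \<in> borel_measurable lborel"
    by measurable
  have "cmod (f x) * cmod (g x) \<le> (cmod (f x))\<^sup>2 + (cmod (g x))\<^sup>2" for x
  proof -
    have "2 * (cmod (f x) * cmod (g x)) \<le> (cmod (f x))\<^sup>2 + (cmod (g x))\<^sup>2"
      using zero_le_power2[of "cmod (f x) - cmod (g x)"] by (simp add: power2_diff)
    moreover have "0 \<le> cmod (f x) * cmod (g x)" by simp
    ultimately show ?thesis by linarith
  qed
  then show "AE x in lborel. norm (f x * cnj (g x)) \<le> norm ((cmod (f x))\<^sup>2 + (cmod (g x))\<^sup>2)"
    by (auto simp: norm_mult)
qed

lemma AE_affine_eq:
  assumes "square_integrable f" "square_integrable g" "AE x in lborel. f x = g x" "a \<noteq> 0"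
  shows "AE x in lborel. f (a * x + b) = g (a * x + (b::real))"
proof -
  have [measurable]: "f \<in> borel_measurable borel" "g \<in> borel_measurable borel"
    using assms by (auto simp: square_integrable_def)
  have "AE x in lborel. f (b + a * x) = g (b + a * x)"
    using assms by (intro AE_borel_affine) auto
  then show ?thesis by (simp add: add.commute)
qed

quotient_type L2 = "real \<Rightarrow> complex" / partial: L2_rel
proof (rule part_equivpI)
  show "\<exists>f. L2_rel f f"
    using square_integrable_zero by (auto simp: L2_rel_def)
  show "symp L2_rel"
    by (auto simp: symp_def L2_rel_def eq_commute)
  show "transp L2_rel"
  proof (rule transpI)
    fix f g h assume fg: "L2_rel f g" and gh: "L2_rel g h"
    have "AE x in lborel. f x = g x" "AE x in lborel. g x = h x"
      using fg gh by (simp_all add: L2_rel_def)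
    then have "AE x in lborel. f x = h x"
      by eventually_elim simp
    then show "L2_rel f h"
      using fg gh by (simp add: L2_rel_def)
  qed
qed

instantiation L2 :: ab_group_add
begin

lift_definition zero_L2 :: L2 is "\<lambda>x. 0"
  by (simp add: L2_rel_def square_integrable_zero)

lift_definition plus_L2 :: "L2 \<Rightarrow> L2 \<Rightarrow> L2" is "\<lambda>f g x. f x + g x"
  by (auto simp: L2_rel_def square_integrable_add)

lift_definition uminus_L2 :: "L2 \<Rightarrow> L2" is "\<lambda>f x. - f x"
  using square_integrable_cmult[where c = "-1"] by (auto simp: L2_rel_def)

definition minus_L2 :: "L2 \<Rightarrow> L2 \<Rightarrow> L2" where
  "minus_L2 f g = f + - g"

instance
proof
  fix f g h :: L2
  show "f + g + h = f + (g + h)"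
    by transfer (auto simp: L2_rel_def square_integrable_add add.assoc)
  show "f + g = g + f"
    by transfer (auto simp: L2_rel_def square_integrable_add add.commute)
  show "0 + f = f"
    by transfer (auto simp: L2_rel_def)
  show "- f + f = 0"
    by transfer (auto simp: L2_rel_def square_integrable_zero)
  show "f - g = f + - g"
    by (rule minus_L2_def)
qed

end

lift_definition scaleC :: "complex \<Rightarrow> L2 \<Rightarrow> L2" (infixr \<open>*\<^sub>C\<close> 75) is "\<lambda>c f x. c * f x"
  by (auto simp: L2_rel_def square_integrable_cmult)

global_interpretation L2: vector_space scaleC
  defines cspan = "L2.span"
proof
  fix a b :: complex and f g :: L2
  show "a *\<^sub>C (f + g) = a *\<^sub>C f + a *\<^sub>C g"
    by transfer
      (auto simp: L2_rel_def distrib_left intro!: square_integrable_add square_integrable_cmult)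
  show "(a + b) *\<^sub>C f = a *\<^sub>C f + b *\<^sub>C f"
    by transfer
      (auto simp: L2_rel_def distrib_right intro!: square_integrable_add square_integrable_cmult)
  show "a *\<^sub>C b *\<^sub>C f = (a * b) *\<^sub>C f"
    by transfer (auto simp: L2_rel_def mult.assoc intro!: square_integrable_cmult)
  show "1 *\<^sub>C f = f"
    by transfer (auto simp: L2_rel_def)
qed

text \<open>Linear in the first argument.\<close>

lift_definition cinner :: "L2 \<Rightarrow> L2 \<Rightarrow> complex" is
  "\<lambda>f g. integral\<^sup>L lborel (\<lambda>x. f x * cnj (g x))"
proof -
  fix f f' g g' :: "real \<Rightarrow> complex"
  assume f: "L2_rel f f'" and g: "L2_rel g g'"
  show "integral\<^sup>L lborel (\<lambda>x. f x * cnj (g x)) = integral\<^sup>L lborel (\<lambda>x. f' x * cnj (g' x))"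
  proof (rule integral_cong_AE)
    show "AE x in lborel. f x * cnj (g x) = f' x * cnj (g' x)"
      using f g by (auto simp: L2_rel_def)
    show "(\<lambda>x. f x * cnj (g x)) \<in> borel_measurable lborel"
      "(\<lambda>x. f' x * cnj (g' x)) \<in> borel_measurable lborel"
      using f g integrable_mult_cnj[THEN borel_measurable_integrable] by (simp_all add: L2_rel_def)
  qed
qed

lemma cinner_add_left: "cinner (f + g) h = cinner f h + cinner g h"
  by transfer (simp add: L2_rel_def ring_distribs integrable_mult_cnj)

lemma cinner_scaleC_left: "cinner (c *\<^sub>C f) g = c * cinner f g"
  by transfer (simp add: mult.assoc)

lemma cinner_cnj: "cinner f g = cnj (cinner g f)"
proof transfer
  fix f g :: "real \<Rightarrow> complex"
  have "cnj (integral\<^sup>L lborel (\<lambda>x. g x * cnj (f x))) = integral\<^sup>L lborel (\<lambda>x. cnj (g x * cnj (f x)))"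
    by (rule Bochner_Integration.integral_cnj[symmetric])
  then show "integral\<^sup>L lborel (\<lambda>x. f x * cnj (g x)) = cnj (integral\<^sup>L lborel (\<lambda>x. g x * cnj (f x)))"
    by (simp add: mult.commute)
qed

lemma Re_cinner_self:
  "Re (integral\<^sup>L lborel (\<lambda>x. f x * cnj (f x))) = integral\<^sup>L lborel (\<lambda>x. (cmod (f x))\<^sup>2)"
proof -
  have "(\<lambda>x. f x * cnj (f x)) = (\<lambda>x. complex_of_real ((cmod (f x))\<^sup>2))"
    by (rule ext) (rule complex_norm_square[symmetric])
  then show ?thesis by (simp only: integral_complex_of_real Re_complex_of_real)
qed

instantiation L2 :: real_inner
begin

definition scaleR_L2 :: "real \<Rightarrow> L2 \<Rightarrow> L2" where
  "scaleR_L2 r f = of_real r *\<^sub>C f"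

definition inner_L2 :: "L2 \<Rightarrow> L2 \<Rightarrow> real" where
  "inner_L2 f g = Re (cinner f g)"

definition norm_L2 :: "L2 \<Rightarrow> real" where
  "norm_L2 f = sqrt (Re (cinner f f))"

definition sgn_L2 :: "L2 \<Rightarrow> L2" where
  "sgn_L2 f = inverse (norm f) *\<^sub>R f"

definition dist_L2 :: "L2 \<Rightarrow> L2 \<Rightarrow> real" where
  "dist_L2 f g = norm (f - g)"

definition uniformity_L2 :: "(L2 \<times> L2) filter" where
  "uniformity_L2 = (INF e\<in>{0<..}. principal {(f, g). dist f g < e})"

definition open_L2 :: "L2 set \<Rightarrow> bool" where
  "open_L2 S \<longleftrightarrow> (\<forall>f\<in>S. \<forall>\<^sub>F (f', g) in uniformity. f' = f \<longrightarrow> g \<in> S)"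

instance
proof
  fix f g h :: L2 and r s :: real and S :: "L2 set"
  show "r *\<^sub>R (f + g) = r *\<^sub>R f + r *\<^sub>R g"
    by (simp add: scaleR_L2_def L2.scale_right_distrib)
  show "(r + s) *\<^sub>R f = r *\<^sub>R f + s *\<^sub>R f"
    by (simp add: scaleR_L2_def L2.scale_left_distrib)
  show "r *\<^sub>R s *\<^sub>R f = (r * s) *\<^sub>R f"
    by (simp add: scaleR_L2_def)
  show "1 *\<^sub>R f = f"
    by (simp add: scaleR_L2_def)
  show "inner f g = inner g f"
    unfolding inner_L2_def by (subst cinner_cnj) simp
  show "inner (f + g) h = inner f h + inner g h"
    by (simp add: inner_L2_def cinner_add_left)
  show "inner (r *\<^sub>R f) g = r * inner f g"
    by (simp add: inner_L2_def scaleR_L2_def cinner_scaleC_left)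
  show "0 \<le> inner f f"
    unfolding inner_L2_def
    by transfer (simp add: L2_rel_def Re_cinner_self)
  show "(inner f f = 0) = (f = 0)"
    unfolding inner_L2_def
  proof transfer
    fix f :: "real \<Rightarrow> complex"
    assume "L2_rel f f"
    then have f: "square_integrable f" by (simp add: L2_rel_def)
    have "(integral\<^sup>L lborel (\<lambda>x. (cmod (f x))\<^sup>2) = 0) = (AE x in lborel. (cmod (f x))\<^sup>2 = 0)"
      using f by (intro integral_nonneg_eq_0_iff_AE) (auto simp: square_integrable_def)
    then show "(Re (integral\<^sup>L lborel (\<lambda>x. f x * cnj (f x))) = 0) = L2_rel f (\<lambda>x. 0)"
      using f by (simp add: Re_cinner_self L2_rel_def square_integrable_zero)
  qed
  show "norm f = sqrt (inner f f)"
    by (simp add: norm_L2_def inner_L2_def)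
  show "sgn f = inverse (norm f) *\<^sub>R f"
    by (rule sgn_L2_def)
  show "dist f g = norm (f - g)"
    by (rule dist_L2_def)
  show "(uniformity :: (L2 \<times> L2) filter) = (INF e\<in>{0<..}. principal {(f, g). dist f g < e})"
    by (rule uniformity_L2_def)
  show "open S = (\<forall>f\<in>S. \<forall>\<^sub>F (f', g) in uniformity. f' = f \<longrightarrow> g \<in> S)"
    by (rule open_L2_def)
qed

end

section \<open>Operators\<close>

definition bounded_op :: "(L2 \<Rightarrow> L2) \<Rightarrow> bool" where
  "bounded_op A \<longleftrightarrow> bounded_linear A \<and> (\<forall>c f. A (c *\<^sub>C f) = c *\<^sub>C A f)"

definition unitary_op :: "(L2 \<Rightarrow> L2) \<Rightarrow> bool" where
  "unitary_op A \<longleftrightarrow> bounded_op A \<and> surj A \<and> (\<forall>f g. cinner (A f) (A g) = cinner f g)"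

definition adjoint_op :: "(L2 \<Rightarrow> L2) \<Rightarrow> (L2 \<Rightarrow> L2)" where
  "adjoint_op A = (THE B. \<forall>f g. cinner (A f) g = cinner f (B g))"

definition commutant :: "(L2 \<Rightarrow> L2) set \<Rightarrow> (L2 \<Rightarrow> L2) set" where
  "commutant S = {A. bounded_op A \<and> (\<forall>B\<in>S. A \<circ> B = B \<circ> A)}"

text \<open>Integer powers; meaningful for bijective operators.\<close>

definition op_powi :: "(L2 \<Rightarrow> L2) \<Rightarrow> int \<Rightarrow> (L2 \<Rightarrow> L2)" where
  "op_powi A n = (if 0 \<le> n then A ^^ nat n else inv A ^^ nat (- n))"

lemma unitary_op_inj:
  assumes "unitary_op A"
  shows "inj A"
proof (rule injI)
  fix f g assume eq: "A f = A g"
  have lin: "bounded_linear A"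
    using assms by (auto simp: unitary_op_def bounded_op_def)
  have "cinner (f - g) (f - g) = cinner (A (f - g)) (A (f - g))"
    using assms by (simp add: unitary_op_def)
  also have "A (f - g) = 0"
    using eq lin by (simp add: linear_diff bounded_linear.linear)
  finally have "inner (f - g) (f - g) = inner 0 (0::L2)"
    by (simp add: inner_L2_def)
  then show "f = g" by simp
qed

lemma unitary_op_adjoint_op:
  assumes "unitary_op A"
  shows "adjoint_op A = inv A"
proof -
  have surj: "surj A" and iso: "\<And>f g. cinner (A f) (A g) = cinner f g"
    using assms unfolding unitary_op_def by blast+
  have *: "cinner (A f) g = cinner f (inv A g)" for f g
    using iso[of f "inv A g"] unfolding surj_f_inv_f[OF surj] .
  show ?thesis unfolding adjoint_op_def
  proof (rule the_equality)
    show "\<forall>f g. cinner (A f) g = cinner f (inv A g)"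
      using * by iprover
    fix B assume B: "\<forall>f g. cinner (A f) g = cinner f (B g)"
    show "B = inv A"
    proof
      fix g
      have "\<forall>f. inner f (B g) = inner f (inv A g)"
      proof
        fix f
        have "cinner f (B g) = cinner f (inv A g)"
          by (rule trans[OF B[rule_format, symmetric] *])
        then show "inner f (B g) = inner f (inv A g)"
          by (simp only: inner_L2_def)
      qed
      then show "B g = inv A g"
        by (rule vector_eq_ldot[THEN iffD1])
    qed
  qed
qed

lift_definition D :: "L2 \<Rightarrow> L2" is "\<lambda>f x. of_real (sqrt 2) * f (2 * x)"
proof -
  fix f g :: "real \<Rightarrow> complex" assume "L2_rel f g"
  then show "L2_rel (\<lambda>x. of_real (sqrt 2) * f (2 * x)) (\<lambda>x. of_real (sqrt 2) * g (2 * x))"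
    using square_integrable_affine[of _ 2 0] AE_affine_eq[of f g 2 0]
    by (auto simp: L2_rel_def intro!: square_integrable_cmult)
qed

lift_definition T :: "L2 \<Rightarrow> L2" is "\<lambda>f x. f (x + 1)"
proof -
  fix f g :: "real \<Rightarrow> complex" assume "L2_rel f g"
  then show "L2_rel (\<lambda>x. f (x + 1)) (\<lambda>x. g (x + 1))"
    using square_integrable_affine[of _ 1 1] AE_affine_eq[of f g 1 1]
    by (auto simp: L2_rel_def)
qed

section \<open>Wavelets\<close>

lift_definition wavelet_fn :: "int \<Rightarrow> int \<Rightarrow> L2 \<Rightarrow> L2" is
  "\<lambda>j n f x. of_real (2 powr (of_int j / 2)) * f (2 powr of_int j * x + of_int n)"
proof -
  fix j n :: int and f g :: "real \<Rightarrow> complex" assume "L2_rel f g"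
  then show "L2_rel
     (\<lambda>x. of_real (2 powr (of_int j / 2)) * f (2 powr of_int j * x + of_int n))
     (\<lambda>x. of_real (2 powr (of_int j / 2)) * g (2 powr of_int j * x + of_int n))"
    using square_integrable_affine[of _ "2 powr of_int j" "of_int n"]
      AE_affine_eq[of f g "2 powr of_int j" "of_int n"]
    by (auto simp: L2_rel_def intro!: square_integrable_cmult)
qed

lemma L2_rel_wavelet_fn:
  assumes "L2_rel f f" "g = (\<lambda>x. of_real (2 powr (of_int j / 2)) * f (2 powr of_int j * x + of_int n))"
  shows "L2_rel g g"
  using assms square_integrable_affine[of f "2 powr of_int j" "of_int n"]
  by (auto simp: L2_rel_def intro!: square_integrable_cmult)

lemma wavelet_fn_0_0: "wavelet_fn 0 0 f = f"
  by transfer (simp add: L2_rel_def)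

lemma wavelet_fn_split: "wavelet_fn j 0 (wavelet_fn 0 n f) = wavelet_fn j n f"
proof transfer
  fix j n :: int and f :: "real \<Rightarrow> complex"
  assume "L2_rel f f"
  from L2_rel_wavelet_fn[OF this refl, of j n]
  show "L2_rel (\<lambda>x. complex_of_real (2 powr (of_int j / 2)) *
      (complex_of_real (2 powr (of_int 0 / 2)) *
        f (2 powr of_int 0 * (2 powr of_int j * x + of_int 0) + of_int n)))
      (\<lambda>x. complex_of_real (2 powr (of_int j / 2)) * f (2 powr of_int j * x + of_int n))"
    by simp
qed

lemma wavelet_fn_dilations: "wavelet_fn i 0 (wavelet_fn j 0 f) = wavelet_fn (i + j) 0 f"
proof transfer
  fix i j :: int and f :: "real \<Rightarrow> complex"
  assume f: "L2_rel f f"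
  let ?g = "\<lambda>x. complex_of_real (2 powr (of_int (i + j) / 2)) * f (2 powr of_int (i + j) * x + of_int 0)"
  have "(\<lambda>x. complex_of_real (2 powr (of_int i / 2)) *
      (complex_of_real (2 powr (of_int j / 2)) *
        f (2 powr of_int j * (2 powr of_int i * x + of_int 0) + of_int 0))) = ?g"
  proof
    fix x
    have "complex_of_real (2 powr (of_int (i + j) / 2)) =
        complex_of_real (2 powr (of_int i / 2)) * complex_of_real (2 powr (of_int j / 2))"
      by (simp add: powr_add add_divide_distrib)
    then show "complex_of_real (2 powr (of_int i / 2)) *
      (complex_of_real (2 powr (of_int j / 2)) *
        f (2 powr of_int j * (2 powr of_int i * x + of_int 0) + of_int 0)) = ?g x"
      by (simp add: powr_add mult_ac)
  qed
  then show "L2_rel (\<lambda>x. complex_of_real (2 powr (of_int i / 2)) *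
      (complex_of_real (2 powr (of_int j / 2)) *
        f (2 powr of_int j * (2 powr of_int i * x + of_int 0) + of_int 0))) ?g"
    using L2_rel_wavelet_fn[OF f refl, of "i + j" 0] by simp
qed

lemma wavelet_fn_translations: "wavelet_fn 0 m (wavelet_fn 0 n f) = wavelet_fn 0 (m + n) f"
proof transfer
  fix m n :: int and f :: "real \<Rightarrow> complex"
  assume "L2_rel f f"
  from L2_rel_wavelet_fn[OF this refl, of 0 "m + n"]
  show "L2_rel (\<lambda>x. complex_of_real (2 powr (of_int 0 / 2)) *
      (complex_of_real (2 powr (of_int 0 / 2)) *
        f (2 powr of_int 0 * (2 powr of_int 0 * x + of_int m) + of_int n)))
      (\<lambda>x. complex_of_real (2 powr (of_int 0 / 2)) * f (2 powr of_int 0 * x + of_int (m + n)))"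
    by (simp add: add.assoc)
qed

lemma D_eq_wavelet_fn: "D = wavelet_fn 1 0"
proof
  fix f show "D f = wavelet_fn 1 0 f"
  proof transfer
    fix f :: "real \<Rightarrow> complex"
    assume "L2_rel f f"
    from L2_rel_wavelet_fn[OF this refl, of 1 0]
    show "L2_rel (\<lambda>x. of_real (sqrt 2) * f (2 * x))
      (\<lambda>x. of_real (2 powr (of_int 1 / 2)) * f (2 powr of_int 1 * x + of_int 0))"
      by (simp add: powr_half_sqrt)
  qed
qed

lemma T_eq_wavelet_fn: "T = wavelet_fn 0 1"
proof
  fix f show "T f = wavelet_fn 0 1 f"
  proof transfer
    fix f :: "real \<Rightarrow> complex"
    assume "L2_rel f f"
    from L2_rel_wavelet_fn[OF this refl, of 0 1]
    show "L2_rel (\<lambda>x. f (x + 1))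
      (\<lambda>x. of_real (2 powr (of_int 0 / 2)) * f (2 powr of_int 0 * x + of_int 1))"
      by simp
  qed
qed

lemma op_powi_additive:
  assumes zero: "\<And>f. P 0 f = f" and add: "\<And>i j f. P i (P j f) = P (i + j) f"
  shows "op_powi (P 1) n = P n"
proof -
  have pow: "P i ^^ m = P (int m * i)" for i m
    by (induction m) (auto simp: zero add fun_eq_iff algebra_simps)
  have "inv (P 1) = P (-1)"
    by (rule inv_equality) (simp_all add: zero add)
  then show ?thesis by (auto simp: op_powi_def pow)
qed

lemma op_powi_D: "op_powi D j = wavelet_fn j 0"
  unfolding D_eq_wavelet_fn
  by (rule op_powi_additive) (simp_all add: wavelet_fn_0_0 wavelet_fn_dilations)

lemma op_powi_T: "op_powi T n = wavelet_fn 0 n"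
  unfolding T_eq_wavelet_fn
  by (rule op_powi_additive) (simp_all add: wavelet_fn_0_0 wavelet_fn_translations)

lemma op_powi_D_T: "op_powi D j (op_powi T n f) = wavelet_fn j n f"
  by (simp add: op_powi_D op_powi_T wavelet_fn_split)

lemma cinner_wavelet_fn: "cinner (wavelet_fn j n f) (wavelet_fn j n g) = cinner f g"
proof transfer
  fix j n :: int and f g :: "real \<Rightarrow> complex"
  define a :: real where "a = 2 powr of_int j"
  have a: "a > 0" by (simp add: a_def)
  have "2 powr (of_int j / 2) * 2 powr (of_int j / 2) = a"
    by (simp add: a_def flip: powr_add)
  then have c: "complex_of_real (2 powr (of_int j / 2)) * complex_of_real (2 powr (of_int j / 2)) = of_real a"
    by (metis of_real_mult)
  have "(\<lambda>x. complex_of_real (2 powr (of_int j / 2)) * f (a * x + of_int n) *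
      cnj (complex_of_real (2 powr (of_int j / 2)) * g (a * x + of_int n))) =
      (\<lambda>x. of_real a * (f (of_int n + a * x) * cnj (g (of_int n + a * x))))"
    by (simp add: c[symmetric] add.commute mult_ac)
  moreover have "integral\<^sup>L lborel (\<lambda>x. f x * cnj (g x)) =
      \<bar>a\<bar> *\<^sub>R integral\<^sup>L lborel (\<lambda>x. f (of_int n + a * x) * cnj (g (of_int n + a * x)))"
    using a by (intro lborel_integral_real_affine) auto
  ultimately show "integral\<^sup>L lborel (\<lambda>x. complex_of_real (2 powr (of_int j / 2)) *
        f (2 powr of_int j * x + of_int n) *
      cnj (complex_of_real (2 powr (of_int j / 2)) * g (2 powr of_int j * x + of_int n))) =
      integral\<^sup>L lborel (\<lambda>x. f x * cnj (g x))"
    using a unfolding a_def[symmetric] by (simp add: scaleR_conv_of_real)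
qed

lemma unitary_op_wavelet_fn:
  assumes "P = wavelet_fn j n" "\<And>f. P (Q f) = f"
  shows "unitary_op P"
proof -
  have add: "P (f + g) = P f + P g" for f g
    unfolding assms(1)
  proof transfer
    fix j n :: int and f g :: "real \<Rightarrow> complex"
    assume "L2_rel f f" "L2_rel g g"
    then have "L2_rel (\<lambda>x. f x + g x) (\<lambda>x. f x + g x)"
      by (simp add: L2_rel_def square_integrable_add)
    from L2_rel_wavelet_fn[OF this refl, of j n]
    show "L2_rel (\<lambda>x. complex_of_real (2 powr (of_int j / 2)) *
        (f (2 powr of_int j * x + of_int n) + g (2 powr of_int j * x + of_int n)))
      (\<lambda>x. complex_of_real (2 powr (of_int j / 2)) * f (2 powr of_int j * x + of_int n) +
        complex_of_real (2 powr (of_int j / 2)) * g (2 powr of_int j * x + of_int n))"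
      by (simp add: distrib_left)
  qed
  have scale: "P (c *\<^sub>C f) = c *\<^sub>C P f" for c f
    unfolding assms(1)
  proof transfer
    fix j n :: int and c and f :: "real \<Rightarrow> complex"
    assume "L2_rel f f"
    then have "L2_rel (\<lambda>x. c * f x) (\<lambda>x. c * f x)"
      by (simp add: L2_rel_def square_integrable_cmult)
    from L2_rel_wavelet_fn[OF this refl, of j n]
    show "L2_rel (\<lambda>x. complex_of_real (2 powr (of_int j / 2)) *
        (c * f (2 powr of_int j * x + of_int n)))
      (\<lambda>x. c * (complex_of_real (2 powr (of_int j / 2)) * f (2 powr of_int j * x + of_int n)))"
      by (simp add: mult.left_commute)
  qed
  have iso: "cinner (P f) (P g) = cinner f g" for f g
    unfolding assms(1) by (rule cinner_wavelet_fn)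
  have "bounded_linear P"
  proof (rule bounded_linear_intro)
    show "P (f + g) = P f + P g" for f g by (rule add)
    show "P (r *\<^sub>R f) = r *\<^sub>R P f" for r f
      by (simp add: scaleR_L2_def scale)
    show "norm (P f) \<le> norm f * 1" for f
      by (simp add: norm_L2_def iso)
  qed
  moreover have "surj P" using assms(2) by (rule surjI)
  ultimately show ?thesis
    by (simp add: unitary_op_def bounded_op_def scale iso)
qed

lemma unitary_op_D: "unitary_op D"
  by (rule unitary_op_wavelet_fn[OF D_eq_wavelet_fn, of "wavelet_fn (-1) 0"])
    (simp add: D_eq_wavelet_fn wavelet_fn_dilations wavelet_fn_0_0)

lemma unitary_op_T: "unitary_op T"
  by (rule unitary_op_wavelet_fn[OF T_eq_wavelet_fn, of "wavelet_fn 0 (-1)"])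
    (simp add: T_eq_wavelet_fn wavelet_fn_translations wavelet_fn_0_0)

definition orthonormal_basis :: "('i \<Rightarrow> L2) \<Rightarrow> bool" where
  "orthonormal_basis e \<longleftrightarrow>
     (\<forall>i i'. cinner (e i) (e i') = (if i = i' then 1 else 0)) \<and>
     closure (cspan (range e)) = UNIV"

definition wavelet :: "L2 \<Rightarrow> bool" where
  "wavelet \<psi> \<longleftrightarrow> orthonormal_basis (\<lambda>(j, n). wavelet_fn j n \<psi>)"

definition local_commutant :: "L2 \<Rightarrow> (L2 \<Rightarrow> L2) set" where
  "local_commutant \<psi> =
     {V. bounded_op V \<and>
         (\<forall>n l. V (op_powi D n (op_powi T l \<psi>)) = op_powi D n (op_powi T l (V \<psi>)))}"

definition core_space :: "L2 \<Rightarrow> L2 set" where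
  "core_space \<psi> = closure (cspan {op_powi D n (op_powi T l \<psi>) | n l. n < 0})"

definition core_rep :: "L2 \<Rightarrow> int \<Rightarrow> L2 \<Rightarrow> L2" where
  "core_rep \<psi> l = restrict (op_powi T l) (core_space \<psi>)"

definition unitary_between :: "L2 set \<Rightarrow> L2 set \<Rightarrow> (L2 \<Rightarrow> L2) \<Rightarrow> bool" where
  "unitary_between M N W \<longleftrightarrow>
     W ` M = N \<and>
     (\<forall>f\<in>M. \<forall>g\<in>M. W (f + g) = W f + W g) \<and>
     (\<forall>c. \<forall>f\<in>M. W (c *\<^sub>C f) = c *\<^sub>C W f) \<and>
     (\<forall>f\<in>M. \<forall>g\<in>M. cinner (W f) (W g) = cinner f g)"

definition core_equivalent :: "L2 \<Rightarrow> L2 \<Rightarrow> bool" where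
  "core_equivalent \<phi> \<psi> \<longleftrightarrow>
     wavelet \<phi> \<and> wavelet \<psi> \<and>
     (\<exists>W. unitary_between (core_space \<phi>) (core_space \<psi>) W \<and>
          (\<forall>l. \<forall>f\<in>core_space \<phi>. W (core_rep \<phi> l f) = core_rep \<psi> l (W f)))"

definition admits_operator_interpolation :: "L2 \<Rightarrow> (L2 \<Rightarrow> L2) \<Rightarrow> nat \<Rightarrow> bool" where
  "admits_operator_interpolation \<psi> U k \<longleftrightarrow>
     k \<ge> 1 \<and> unitary_op U \<and>
     (\<forall>j. U ^^ j \<in> local_commutant \<psi>) \<and>
     U ^^ k = id \<and>
     (\<lambda>A. adjoint_op U \<circ> A \<circ> U) ` commutant {D, T} = commutant {D, T}"

definition interpolation_family :: "L2 \<Rightarrow> (L2 \<Rightarrow> L2) \<Rightarrow> nat \<Rightarrow> L2 set" where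
  "interpolation_family \<psi> U k = {(U ^^ j) \<psi> | j. j < k}"

end

theory Submission
  imports Defs
begin

text \<open>
  The sums \<open>\<Sum> B\<^sub>j U\<^sup>j\<close> with \<open>B\<^sub>j\<close> in the commutant of \<open>D\<close> and \<open>T\<close> form a *-algebra
  \<open>\<N>\<close> (\<open>interpolation_algebra\<close>): conjugation by \<open>U\<close> preserves the commutant, so the powers of
  \<open>U\<close> can be collected on one side, and \<open>U\<close> has finite order, so its inverse is one of its
  powers. Every element of \<open>\<N>\<close> lies in the local commutant at every wavelet
  \<open>\<eta> = U\<^sup>j \<psi>\<close>, and \<open>\<phi> = X \<eta>\<close> for the unitary \<open>X = V U\<^sup>-\<^sup>j\<close> of \<open>\<N>\<close>. It therefore suffices to
  show that \<open>X \<eta>\<close> is core equivalent to \<open>\<eta>\<close> for every unitary \<open>X\<close> of \<open>\<N>\<close>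
  (\<open>core_equivalent_unitary_in_algebra\<close>).

  Such an \<open>X\<close> maps the core space of \<open>\<eta>\<close> onto that of \<open>X \<eta>\<close>, but it need not commute with
  \<open>T\<close> there. A unitary that does commute with \<open>T\<close> can be read off from the mutual position of
  two \<open>T\<close>-reducing subspaces \<open>K\<close> and \<open>L\<close>: if no nonzero vector of either of them is
  orthogonal to the other, then the polar part of the product of their orthogonal projections maps
  \<open>K\<close> onto \<open>L\<close> and commutes with everything that \<open>K\<close> and \<open>L\<close> reduce
  (\<open>generic_position_isometry\<close>). Core spaces are \<open>T\<close>-reducing because the complement of the core
  space of \<open>\<eta>\<close> is spanned by the \<open>D\<^sup>n T\<^sup>l \<eta>\<close> with \<open>n \<ge> 0\<close>, which \<open>T\<close> permutes
  (\<open>core_space_eq_nonneg_scales_perp\<close>).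

  The core spaces of \<open>\<eta>\<close> and \<open>X \<eta>\<close> need not be in this position, so a wavelet is placed
  between them. Let \<open>W\<close> be the principal square root of \<open>X\<close>, which takes \<open>z = e\<^sup>i\<^sup>t\<close> to
  \<open>e\<^sup>i\<^sup>t\<^sup>/\<^sup>2\<close> for \<open>-\<pi> < t \<le> \<pi>\<close> in the spectral decomposition of \<open>X\<close>.
  It is a strong limit of elements of \<open>\<N>\<close>, hence still in the local commutant at \<open>\<eta>\<close>, and \<open>\<langle>W f, f\<rangle> = 0\<close> forces \<open>f = 0\<close>
  (\<open>usqrt_numerical_range\<close>). By the last property \<open>W\<close> moves no nonzero vector of a
  subspace to a position orthogonal to that subspace. So the core spaces of \<open>\<eta>\<close> and \<open>W \<eta>\<close> are in the
  position described above, and so are those of \<open>W \<eta>\<close> and \<open>W\<^sup>2 \<eta> = X \<eta>\<close>.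

  Both the intertwining unitary and the square root are instances of the partial isometry
  in a polar decomposition, constructed for a contraction \<open>R\<close> as the strong limit of
  \<open>R p\<^sub>N(R\<^sup>* R)\<close>, where the \<open>p\<^sub>N\<close> are the Taylor polynomials of \<open>t\<^sup>-\<^sup>1\<^sup>/\<^sup>2\<close> at \<open>1\<close>. This form
  makes it evident which operators commute with it and in which strongly closed sets it lies. The
  argument needs adjoints, projections and strong limits, hence the completeness of \<open>L2\<close>.
\<close>

section \<open>Taylor coefficients of the inverse square root\<close>

text \<open>The coefficients of \<open>(1 - t)\<^sup>-\<^sup>1\<^sup>/\<^sup>2\<close>. They are nonnegative, and the square of their generating
function is the geometric series.\<close>

definition invsqrt_coeff :: "nat \<Rightarrow> real" where
  "invsqrt_coeff n = (- 1) ^ n * ((- 1 / 2) gchoose n)"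

lemma invsqrt_coeff_0: "invsqrt_coeff 0 = 1"
  by (simp add: invsqrt_coeff_def)

lemma invsqrt_coeff_nonneg: "0 \<le> invsqrt_coeff n"
proof -
  have "invsqrt_coeff n = pochhammer (1 / 2) n / fact n"
    by (simp add: invsqrt_coeff_def gbinomial_pochhammer flip: power_add mult.assoc)
  then show ?thesis
    by (simp add: pochhammer_nonneg)
qed

lemma invsqrt_coeff_convolution: "(\<Sum>i\<le>n. invsqrt_coeff i * invsqrt_coeff (n - i)) = 1"
proof -
  have "(\<Sum>i\<le>n. invsqrt_coeff i * invsqrt_coeff (n - i))
      = (\<Sum>i\<le>n. (- 1) ^ n * (((- 1 / 2) gchoose i) * ((- 1 / 2) gchoose (n - i))))"
    by (intro sum.cong refl) (simp add: invsqrt_coeff_def flip: power_add)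
  also have "\<dots> = (- 1) ^ n * ((- 1) gchoose n)"
    using gbinomial_Vandermonde[of "- 1 / 2 :: real" "- 1 / 2" n]
    by (simp add: atLeast0AtMost flip: sum_distrib_left)
  also have "\<dots> = 1"
    by (simp add: gbinomial_minus flip: power_add binomial_gbinomial)
  finally show ?thesis .
qed

text \<open>Replacing \<open>1\<close> by the convolution of the coefficients turns a partial sum into a sum over a
triangle of index pairs. It is then compared with the sum over a square of index pairs, which is
what the squared norm of a partial sum of the series produces.\<close>

lemma sum_eq_invsqrt_triangle:
  "(\<Sum>n<N. b n) = (\<Sum>(i, j)\<in>{(i, j). i + j < N}. invsqrt_coeff i * invsqrt_coeff j * b (i + j))"
proof -
  have "(\<Sum>n<N. b n) = (\<Sum>n<N. \<Sum>i\<le>n. invsqrt_coeff i * invsqrt_coeff (n - i) * b n)"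
    by (simp add: invsqrt_coeff_convolution flip: sum_distrib_right)
  also have "\<dots> = (\<Sum>(n, i)\<in>Sigma {..<N} (\<lambda>n. {..n}). invsqrt_coeff i * invsqrt_coeff (n - i) * b n)"
    by (simp add: sum.Sigma)
  also have "\<dots> = (\<Sum>(i, j)\<in>{(i, j). i + j < N}. invsqrt_coeff i * invsqrt_coeff j * b (i + j))"
    by (rule sum.reindex_bij_witness[where i = "\<lambda>(i, j). (i + j, i)" and j = "\<lambda>(n, i). (i, n - i)"])
       auto
  finally show ?thesis .
qed

lemma invsqrt_square_bounds:
  fixes b :: "nat \<Rightarrow> real"
  assumes b: "\<And>n. 0 \<le> b n"
  shows "(\<Sum>n<N. b n) \<le> (\<Sum>i<N. \<Sum>j<N. invsqrt_coeff i * invsqrt_coeff j * b (i + j))" (is ?lower)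
    and "(\<Sum>i<N. \<Sum>j<N. invsqrt_coeff i * invsqrt_coeff j * b (i + j)) \<le> (\<Sum>n<2 * N. b n)" (is ?upper)
proof -
  have fin: "finite {(i, j). i + j < 2 * N}"
    by (rule finite_subset[of _ "{..<2 * N} \<times> {..<2 * N}"]) auto
  show ?lower
    unfolding sum_eq_invsqrt_triangle[of b] sum.cartesian_product
    by (rule sum_mono2) (auto simp: b invsqrt_coeff_nonneg)
  show ?upper
    unfolding sum_eq_invsqrt_triangle[of b] sum.cartesian_product
    by (rule sum_mono2[OF fin]) (auto simp: b invsqrt_coeff_nonneg)
qed

section \<open>The polar part of a contraction\<close>

definition defect :: "('a \<Rightarrow> 'a) \<Rightarrow> ('a \<Rightarrow> 'a) \<Rightarrow> 'a \<Rightarrow> 'a::ab_group_add" where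
  "defect R S x = x - S (R x)"

text \<open>With \<open>S = R\<^sup>*\<close> and \<open>X = 1 - S R\<close> this is a partial sum of \<open>R (1 - X)\<^sup>-\<^sup>1\<^sup>/\<^sup>2 = R (R\<^sup>* R)\<^sup>-\<^sup>1\<^sup>/\<^sup>2\<close>.
The adjoint is an explicit argument so that exchanging the two arguments gives the same construction for \<open>R\<^sup>*\<close>.\<close>

definition polar_approx :: "('a \<Rightarrow> 'a) \<Rightarrow> ('a \<Rightarrow> 'a) \<Rightarrow> nat \<Rightarrow> 'a \<Rightarrow> 'a::real_vector" where
  "polar_approx R S N x = (\<Sum>n<N. invsqrt_coeff n *\<^sub>R R ((defect R S ^^ n) x))"

definition polar :: "('a \<Rightarrow> 'a) \<Rightarrow> ('a \<Rightarrow> 'a) \<Rightarrow> 'a \<Rightarrow> 'a::real_normed_vector" where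
  "polar R S x = lim (\<lambda>N. polar_approx R S N x)"

text \<open>A contraction \<open>R\<close> of a real Hilbert space with its adjoint \<open>S\<close>. Complex linearity of an
operator is commutation with the multiplication by \<open>\<i>\<close>, so the real theory covers the complex one.\<close>

locale contraction_pair =
  fixes R S :: "'a \<Rightarrow> 'a::{real_inner, complete_space}"
  assumes linR: "linear R" and linS: "linear S"
    and adj: "inner (R x) y = inner x (S y)"
    and contr: "norm (R x) \<le> norm x"
begin

abbreviation X where "X \<equiv> defect R S"

lemma contraction_pair_dual: "contraction_pair S R"
proof (rule contraction_pair.intro)
  show "linear S" "linear R" by (fact linS linR)+
  show adj': "inner (S x) y = inner x (R y)" for x y
    by (metis adj inner_commute)
  show "norm (S x) \<le> norm x" for x
  proof -
    have "norm (S x) * norm (S x) = inner (R (S x)) x"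
      by (simp add: adj flip: power2_norm_eq_inner power2_eq_square)
    also have "\<dots> \<le> norm (R (S x)) * norm x"
      by (rule norm_cauchy_schwarz)
    also have "\<dots> \<le> norm (S x) * norm x"
      by (rule mult_right_mono[OF contr]) simp
    finally show ?thesis
      by (cases "norm (S x) = 0") (auto simp: mult_le_cancel_left)
  qed
qed

lemma linear_defect_pow: "linear (X ^^ n)"
proof (induction n)
  case 0
  then show ?case by (simp add: id_def linear_ident[unfolded id_def])
next
  case (Suc n)
  have "linear X"
    unfolding defect_def
    by (intro linear_compose_sub linear_ident linear_compose[OF linR linS, unfolded o_def])
  from linear_compose[OF Suc this] show ?case
    by (simp add: comp_def)
qed

lemma defect_symmetric: "inner ((X ^^ m) x) y = inner x ((X ^^ m) y)"
proof (induction m arbitrary: x y)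
  case (Suc m)
  have "inner (X x) y = inner x (X y)" for x y
    using contraction_pair.adj[OF contraction_pair_dual]
    by (simp add: defect_def inner_diff_left inner_diff_right adj)
  then show ?case using Suc
    by (metis comp_apply funpow_Suc_right funpow.simps(2))
qed simp

text \<open>The moments of the spectral measure of \<open>x\<close> with respect to \<open>X\<close>. Since \<open>0 \<le> X \<le> 1\<close>, they
are nonnegative and decreasing; all norm estimates for the polar part reduce to this.\<close>

definition moment :: "'a \<Rightarrow> nat \<Rightarrow> real" where
  "moment x n = inner ((X ^^ n) x) x"

lemma inner_pow_pow: "inner ((X ^^ m) x) ((X ^^ n) x) = moment x (m + n)"
  unfolding moment_def
  by (metis add.commute comp_apply defect_symmetric funpow_add inner_commute)

lemma inner_R_pow_pow:
  "inner (R ((X ^^ m) x)) (R ((X ^^ n) x)) = moment x (m + n) - moment x (Suc (m + n))"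
proof -
  have "S (R y) = y - X y" for y
    by (simp add: defect_def)
  then show ?thesis
    using inner_pow_pow[of m x n] inner_pow_pow[of m x "Suc n"]
    by (simp add: adj inner_diff_right)
qed

lemma moment_nonneg: "0 \<le> moment x n"
  and moment_decreasing: "moment x (Suc n) \<le> moment x n"
proof -
  have le: "inner (X y) y \<le> inner y y" for y
    by (simp add: defect_def inner_diff_left) (metis adj inner_commute inner_ge_zero)
  have ge: "0 \<le> inner (X y) y" for y
  proof -
    have "inner (R y) (R y) \<le> inner y y"
      using contr[of y] by (simp add: norm_le)
    then show ?thesis
      by (simp add: defect_def inner_diff_left) (metis adj inner_commute)
  qed
  have even: "moment x (2 * m) \<ge> 0" "moment x (Suc (2 * m)) \<ge> 0" "moment x (Suc (2 * m)) \<le> moment x (2 * m)" for m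
    using ge[of "(X ^^ m) x"] le[of "(X ^^ m) x"] inner_pow_pow[of m x m] inner_pow_pow[of "Suc m" x m]
      inner_ge_zero[of "(X ^^ m) x"]
    by (simp_all add: mult_2)
  \<comment> \<open>positivity of \<open>X - X\<^sup>2 = X (1 - X) X + (1 - X) X (1 - X)\<close>\<close>
  have odd: "moment x (Suc (Suc (2 * m))) \<le> moment x (Suc (2 * m))" for m
  proof -
    define y where "y = (X ^^ m) x"
    have lin: "X (y - X y) = X y - X (X y)"
      using linear_defect_pow[of 1] by (simp add: linear_diff)
    have "inner (X (X y)) (X y) \<le> inner (X y) (X y)" by (rule le)
    moreover have "0 \<le> inner (X (y - X y)) (y - X y)" by (rule ge)
    ultimately have "inner (X y) (X y) \<le> inner (X y) y"
      using defect_symmetric[of 1 "X y" y]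
      by (simp add: lin inner_diff_left inner_diff_right inner_commute)
    then show ?thesis
      using inner_pow_pow[of "Suc m" x "Suc m"] inner_pow_pow[of "Suc m" x m]
      by (simp add: y_def mult_2)
  qed
  show "0 \<le> moment x n"
    using even(1,2) by (cases "even n") (auto elim!: evenE oddE)
  show "moment x (Suc n) \<le> moment x n"
    using even(3) odd by (cases "even n") (auto elim!: evenE oddE)
qed

definition gap where "gap x n = moment x n - moment x (Suc n)"

lemma gap_nonneg: "0 \<le> gap x n"
  using moment_decreasing[of x n] by (simp add: gap_def)

lemma sum_gap: "(\<Sum>n<N. gap x n) = moment x 0 - moment x N"
  by (simp add: gap_def sum_lessThan_telescope')

lemma inner_combinations:
  assumes "finite I" "finite J"
  shows "inner (\<Sum>n\<in>I. invsqrt_coeff n *\<^sub>R R ((X ^^ n) x)) (\<Sum>n\<in>J. invsqrt_coeff n *\<^sub>R R ((X ^^ n) x))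
    = (\<Sum>i\<in>I. \<Sum>j\<in>J. invsqrt_coeff i * invsqrt_coeff j * gap x (i + j))"
  by (simp add: inner_sum_left inner_sum_right inner_R_pow_pow gap_def mult_ac sum_distrib_left
      sum.swap[of _ J I])

lemma norm_polar_approx:
  "(norm (polar_approx R S N x))\<^sup>2 = (\<Sum>i<N. \<Sum>j<N. invsqrt_coeff i * invsqrt_coeff j * gap x (i + j))"
  unfolding polar_approx_def power2_norm_eq_inner by (rule inner_combinations) simp_all

text \<open>The square of the \<open>N\<close>-th partial sum of \<open>(1 - t)\<^sup>-\<^sup>1\<^sup>/\<^sup>2\<close> lies coefficientwise between two partial
sums of the geometric series, and the factor \<open>R\<^sup>* R = 1 - X\<close> makes the latter telescope.\<close>

lemma polar_approx_bounds:
  "moment x 0 - moment x N \<le> (norm (polar_approx R S N x))\<^sup>2"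
  "(norm (polar_approx R S N x))\<^sup>2 \<le> moment x 0"
proof -
  show "moment x 0 - moment x N \<le> (norm (polar_approx R S N x))\<^sup>2"
    unfolding norm_polar_approx sum_gap[symmetric]
    by (rule invsqrt_square_bounds) (rule gap_nonneg)
  have "(norm (polar_approx R S N x))\<^sup>2 \<le> (\<Sum>n<2 * N. gap x n)"
    unfolding norm_polar_approx
    by (rule invsqrt_square_bounds) (rule gap_nonneg)
  also have "\<dots> \<le> moment x 0"
    by (simp add: sum_gap moment_nonneg)
  finally show "(norm (polar_approx R S N x))\<^sup>2 \<le> moment x 0" .
qed

text \<open>All mixed terms are nonnegative, so the squared norm grows by at least the square of the
distance moved. Bounded squared norms thus make the approximations a Cauchy sequence.\<close>

lemma polar_approx_increment:
  assumes "N \<le> M"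
  shows "(norm (polar_approx R S M x - polar_approx R S N x))\<^sup>2
    \<le> (norm (polar_approx R S M x))\<^sup>2 - (norm (polar_approx R S N x))\<^sup>2"
proof -
  define u v where "u = polar_approx R S N x"
    and "v = (\<Sum>n\<in>{N..<M}. invsqrt_coeff n *\<^sub>R R ((X ^^ n) x))"
  have "{..<M} = {..<N} \<union> {N..<M}" using assms by auto
  then have M: "polar_approx R S M x = u + v"
    unfolding u_def v_def polar_approx_def by (simp add: sum.union_disjoint ivl_disj_int)
  have "0 \<le> inner u v"
    unfolding u_def v_def polar_approx_def
    by (simp add: inner_combinations sum_nonneg invsqrt_coeff_nonneg gap_nonneg)
  then show ?thesis
    unfolding M u_def[symmetric]
    by (simp add: power2_norm_eq_inner inner_add_left inner_add_right inner_commute)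
qed

lemma LIMSEQ_polar: "(\<lambda>N. polar_approx R S N x) \<longlonglongrightarrow> polar R S x"
proof -
  define f where "f N = (norm (polar_approx R S N x))\<^sup>2" for N
  have incr: "(norm (polar_approx R S M x - polar_approx R S N x))\<^sup>2 \<le> f M - f N" if "N \<le> M" for N M
    using polar_approx_increment[OF that] by (simp add: f_def)
  have "incseq f"
    unfolding incseq_def using incr by (meson diff_ge_0_iff_ge order_trans zero_le_power2)
  moreover have "\<forall>N. f N \<le> moment x 0"
    using polar_approx_bounds(2) by (simp add: f_def)
  ultimately have "convergent f"
    unfolding convergent_def by (rule incseq_convergent) blast
  then have "Cauchy f"
    by (rule convergent_Cauchy)
  have "Cauchy (\<lambda>N. polar_approx R S N x)"
  proof (rule CauchyI')
    fix e :: real assume e: "0 < e"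
    then obtain N0 where N0: "\<And>m n. N0 \<le> m \<Longrightarrow> N0 \<le> n \<Longrightarrow> norm (f m - f n) < e\<^sup>2"
      using CauchyD[OF \<open>Cauchy f\<close>, of "e\<^sup>2"] by auto
    have "norm (polar_approx R S m x - polar_approx R S n x) < e" if "N0 \<le> m" "m < n" for m n
    proof -
      have "(norm (polar_approx R S n x - polar_approx R S m x))\<^sup>2 < e\<^sup>2"
        using incr[of m n] N0[of n m] that by auto
      then show ?thesis
        using e by (simp add: norm_minus_commute power_less_imp_less_base)
    qed
    then show "\<exists>M. \<forall>m\<ge>M. \<forall>n>m. dist (polar_approx R S m x) (polar_approx R S n x) < e"
      by (auto simp: dist_norm)
  qed
  then show ?thesis
    unfolding polar_def by (simp add: Cauchy_convergent convergent_LIMSEQ_iff[symmetric])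
qed

lemma linear_polar_approx: "linear (polar_approx R S N)"
proof
  show "polar_approx R S N (x + y) = polar_approx R S N x + polar_approx R S N y" for x y
    unfolding polar_approx_def
    by (simp add: linear_add[OF linear_defect_pow] linear_add[OF linR] scaleR_add_right sum.distrib)
  show "polar_approx R S N (r *\<^sub>R x) = r *\<^sub>R polar_approx R S N x" for r x
    unfolding polar_approx_def
    by (simp add: linear_scale[OF linear_defect_pow] linear_scale[OF linR] scaleR_sum_right mult.commute)
qed

lemma linear_polar: "linear (polar R S)"
proof
  show "polar R S (x + y) = polar R S x + polar R S y" for x y
    by (rule LIMSEQ_unique[OF LIMSEQ_polar])
      (simp add: linear_add[OF linear_polar_approx] tendsto_add LIMSEQ_polar)
  show "polar R S (r *\<^sub>R x) = r *\<^sub>R polar R S x" for r x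
    by (rule LIMSEQ_unique[OF LIMSEQ_polar])
      (simp add: linear_scale[OF linear_polar_approx] tendsto_scaleR LIMSEQ_polar)
qed

lemma norm_polar_approx_le: "norm (polar_approx R S N x) \<le> norm x"
  using polar_approx_bounds(2)[of N x]
  by (simp add: moment_def flip: power2_norm_eq_inner)

lemma norm_polar_le: "norm (polar R S x) \<le> norm x"
  by (rule Lim_bounded[OF tendsto_norm[OF LIMSEQ_polar]]) (simp add: norm_polar_approx_le)

text \<open>Used to see that the polar part annihilates no more than \<open>R\<close> does.\<close>

lemma norm_le_norm_polar: "norm (R x) \<le> norm (polar R S x)"
proof -
  have "(norm (R x))\<^sup>2 \<le> (norm (polar R S x))\<^sup>2"
  proof (rule LIMSEQ_le_const)
    show "(\<lambda>N. (norm (polar_approx R S N x))\<^sup>2) \<longlonglongrightarrow> (norm (polar R S x))\<^sup>2"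
      by (intro tendsto_power tendsto_norm LIMSEQ_polar)
    have "(norm (R x))\<^sup>2 \<le> (norm (polar_approx R S N x))\<^sup>2" if "1 \<le> N" for N
    proof -
      have "(norm (R x))\<^sup>2 = moment x 0 - moment x 1"
        using inner_R_pow_pow[of 0 x 0] by (simp add: power2_norm_eq_inner)
      also have "\<dots> \<le> moment x 0 - moment x N"
        using lift_Suc_antimono_le[of "moment x", OF moment_decreasing that] by simp
      also have "\<dots> \<le> (norm (polar_approx R S N x))\<^sup>2"
        by (rule polar_approx_bounds)
      finally show ?thesis .
    qed
    then show "\<exists>N. \<forall>n\<ge>N. (norm (R x))\<^sup>2 \<le> (norm (polar_approx R S n x))\<^sup>2"
      by blast
  qed
  then show ?thesis by simp
qed

lemma R_defect_pow: "R ((X ^^ n) x) = (defect S R ^^ n) (R x)"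
proof (induction n)
  case (Suc n)
  have "R (X y) = defect S R (R y)" for y
    by (simp add: defect_def linear_diff[OF linR])
  then show ?case using Suc by simp
qed simp

lemma polar_kernel:
  assumes "R x = 0"
  shows "polar R S x = 0"
proof -
  have "(X ^^ n) x = x" for n
    using linear_0[OF linS] by (induction n) (simp_all add: defect_def assms)
  then have "polar_approx R S N x = 0" for N
    by (simp add: polar_approx_def assms)
  then show ?thesis
    using LIMSEQ_unique[OF LIMSEQ_polar[of x], of 0] by simp
qed

lemma polar_adjoint: "inner (polar R S x) y = inner x (polar S R y)"
proof (rule LIMSEQ_unique)
  show "(\<lambda>N. inner (polar_approx R S N x) y) \<longlonglongrightarrow> inner (polar R S x) y"
    by (intro tendsto_intros LIMSEQ_polar)
  have "inner (polar_approx R S N x) y = inner x (polar_approx S R N y)" for N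
    using contraction_pair.R_defect_pow[OF contraction_pair_dual]
    by (simp add: polar_approx_def inner_sum_left inner_sum_right adj defect_symmetric)
  then show "(\<lambda>N. inner (polar_approx R S N x) y) \<longlonglongrightarrow> inner x (polar S R y)"
    using contraction_pair.LIMSEQ_polar[OF contraction_pair_dual] by (simp add: tendsto_inner)
qed

text \<open>The powers \<open>X\<^sup>n x\<close> converge because the moments do, and their limit lies in the kernel of
\<open>1 - X = R\<^sup>* R\<close>, which is the kernel of \<open>R\<close>. If \<open>x\<close> is orthogonal to this kernel, the limit
of the moments must vanish.\<close>

lemma moment_tendsto_0:
  assumes "\<And>k. R k = 0 \<Longrightarrow> inner x k = 0"
  shows "moment x \<longlonglongrightarrow> 0"
proof -
  have dec: "decseq (moment x)"
    by (simp add: decseq_Suc_iff moment_decreasing)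
  have "\<exists>a. moment x \<longlonglongrightarrow> a"
    by (rule decseq_convergent[OF dec, of 0]) (simp add: moment_nonneg, blast)
  then obtain a where a: "moment x \<longlonglongrightarrow> a" ..
  have dist2: "(dist ((X ^^ m) x) ((X ^^ n) x))\<^sup>2 = moment x (2 * m) - 2 * moment x (m + n) + moment x (2 * n)" for m n
    unfolding dist_norm power2_norm_eq_inner inner_diff_left inner_diff_right inner_pow_pow
    by (simp only: add.commute[of n m] mult_2)
  have "Cauchy (\<lambda>n. (X ^^ n) x)"
  proof (rule metric_CauchyI)
    fix e :: real assume e: "0 < e"
    then obtain N where N: "\<And>n. N \<le> n \<Longrightarrow> norm (moment x n - a) < e\<^sup>2 / 4"
      using LIMSEQ_D[OF a, of "e\<^sup>2 / 4"] by auto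
    have "dist ((X ^^ m) x) ((X ^^ n) x) < e" if "N \<le> m" "N \<le> n" for m n
    proof -
      have "norm (moment x (2 * m) - a) < e\<^sup>2 / 4" "norm (moment x (2 * n) - a) < e\<^sup>2 / 4"
        "norm (moment x (m + n) - a) < e\<^sup>2 / 4"
        by (rule N; use that in simp)+
      then have "(dist ((X ^^ m) x) ((X ^^ n) x))\<^sup>2 < e\<^sup>2"
        unfolding dist2 real_norm_def by linarith
      then show ?thesis
        using e by (simp add: power_less_imp_less_base)
    qed
    then show "\<exists>M. \<forall>m\<ge>M. \<forall>n\<ge>M. dist ((X ^^ m) x) ((X ^^ n) x) < e" by blast
  qed
  then obtain l where l: "(\<lambda>n. (X ^^ n) x) \<longlonglongrightarrow> l"
    using Cauchy_convergent convergent_def by blast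
  have "(\<lambda>n. (norm (R ((X ^^ n) x)))\<^sup>2) \<longlonglongrightarrow> (norm (R l))\<^sup>2"
  proof -
    have "bounded_linear R"
      by (rule bounded_linear_intro[where K = 1]) (simp_all add: linear_add linear_scale linR contr)
    from bounded_linear.tendsto[OF this l] show ?thesis
      by (intro tendsto_power tendsto_norm)
  qed
  moreover have "(\<lambda>n. (norm (R ((X ^^ n) x)))\<^sup>2) \<longlonglongrightarrow> a - a"
  proof -
    have "(norm (R ((X ^^ n) x)))\<^sup>2 = moment x (2 * n) - moment x (Suc (2 * n))" for n
      by (simp add: power2_norm_eq_inner inner_R_pow_pow mult_2)
    moreover have "(\<lambda>n. moment x (2 * n)) \<longlonglongrightarrow> a" "(\<lambda>n. moment x (Suc (2 * n))) \<longlonglongrightarrow> a"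
      using LIMSEQ_subseq_LIMSEQ[OF a, of "\<lambda>n. 2 * n"] LIMSEQ_subseq_LIMSEQ[OF a, of "\<lambda>n. Suc (2 * n)"]
      by (simp_all add: strict_mono_def comp_def)
    ultimately show ?thesis
      by (simp only:) (rule tendsto_diff)
  qed
  ultimately have "R l = 0"
    using LIMSEQ_unique by fastforce
  then have "inner x l = 0"
    by (rule assms)
  moreover have "moment x \<longlonglongrightarrow> inner l x"
    unfolding moment_def by (intro tendsto_intros l)
  ultimately show ?thesis
    by (simp add: inner_commute)
qed

text \<open>The lower bound of the approximations tends to the squared norm of \<open>x\<close> when the moments tend to 0.\<close>

lemma norm_polar:
  assumes "\<And>k. R k = 0 \<Longrightarrow> inner x k = 0"
  shows "norm (polar R S x) = norm x"
proof (rule antisym[OF norm_polar_le])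
  have "moment x 0 - 0 \<le> (norm (polar R S x))\<^sup>2"
  proof (rule LIMSEQ_le)
    show "(\<lambda>N. moment x 0 - moment x N) \<longlonglongrightarrow> moment x 0 - 0"
      by (intro tendsto_intros moment_tendsto_0 assms)
    show "(\<lambda>N. (norm (polar_approx R S N x))\<^sup>2) \<longlonglongrightarrow> (norm (polar R S x))\<^sup>2"
      by (intro tendsto_intros LIMSEQ_polar)
  qed (use polar_approx_bounds in blast)
  then show "norm x \<le> norm (polar R S x)"
    by (simp add: moment_def flip: power2_norm_eq_inner)
qed

text \<open>A contraction that preserves the norm of \<open>x\<close> is inverted at \<open>x\<close> by its adjoint.\<close>

lemma polar_dual_polar:
  assumes "\<And>k. R k = 0 \<Longrightarrow> inner x k = 0"
  shows "polar S R (polar R S x) = x"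
proof -
  let ?y = "polar S R (polar R S x)"
  have "inner ?y x = (norm x)\<^sup>2"
    using contraction_pair.polar_adjoint[OF contraction_pair_dual] norm_polar[OF assms]
    by (simp flip: power2_norm_eq_inner)
  moreover have "norm ?y \<le> norm x"
    using contraction_pair.norm_polar_le[OF contraction_pair_dual] norm_polar_le order_trans by blast
  then have "(norm ?y)\<^sup>2 \<le> (norm x)\<^sup>2"
    by simp
  ultimately have "(norm (?y - x))\<^sup>2 \<le> 0"
    by (simp add: power2_norm_eq_inner inner_diff_left inner_diff_right inner_commute)
  then show ?thesis by simp
qed

text \<open>Let \<open>Z\<close> be the polar part. Its values are orthogonal to the kernel of the adjoint \<open>S\<close>, so
\<open>Z Z\<^sup>* Z = Z\<close>. Thus \<open>1 - Z\<^sup>* Z\<close> maps into the kernel of \<open>Z\<close>, which is contained in that of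
\<open>R\<close>.\<close>

lemma polar_dual_polar_diff_kernel: "R (x - polar S R (polar R S x)) = 0"
proof -
  have "inner (polar R S x) k = 0" if "S k = 0" for k
    using that contraction_pair.polar_kernel[OF contraction_pair_dual] by (simp add: polar_adjoint)
  then have "polar R S (polar S R (polar R S x)) = polar R S x"
    by (rule contraction_pair.polar_dual_polar[OF contraction_pair_dual])
  then have "polar R S (x - polar S R (polar R S x)) = 0"
    by (simp add: linear_diff[OF linear_polar])
  then show ?thesis
    using norm_le_norm_polar[of "x - polar S R (polar R S x)"] by simp
qed

lemma polar_commute:
  assumes G: "bounded_linear G" and R: "\<And>x. G (R x) = R (G x)" and S: "\<And>x. G (S x) = S (G x)"
  shows "G (polar R S x) = polar R S (G x)"
proof (rule LIMSEQ_unique)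
  interpret G: bounded_linear G by (fact G)
  show "(\<lambda>N. G (polar_approx R S N x)) \<longlonglongrightarrow> G (polar R S x)"
    by (intro G.tendsto LIMSEQ_polar)
  have "G ((X ^^ n) x) = (X ^^ n) (G x)" for n
    by (induction n) (simp_all add: defect_def G.diff R S)
  then have "G (polar_approx R S N x) = polar_approx R S N (G x)" for N
    by (simp add: polar_approx_def G.sum G.scaleR R)
  then show "(\<lambda>N. G (polar_approx R S N x)) \<longlonglongrightarrow> polar R S (G x)"
    by (simp add: LIMSEQ_polar)
qed

lemma polar_in_closed_subspace:
  assumes "subspace K" "closed K" "\<And>x. R x \<in> K"
  shows "polar R S x \<in> K"
proof (rule closed_sequentially[OF \<open>closed K\<close> _ LIMSEQ_polar])
  show "polar_approx R S N x \<in> K" for N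
    unfolding polar_approx_def by (intro subspace_sum subspace_scale assms)
qed

end

section \<open>Projections, adjoints and subspaces in generic position\<close>

text \<open>A minimizing sequence for the distance from \<open>x\<close> to \<open>K\<close> is Cauchy by the parallelogram law, and
its limit is the foot of the perpendicular.\<close>

lemma orthogonal_projection_exists:
  fixes K :: "'a::{real_inner, complete_space} set"
  assumes sub: "subspace K" and clo: "closed K"
  shows "\<exists>p\<in>K. \<forall>k\<in>K. inner (x - p) k = 0"
proof -
  define d where "d = (INF k\<in>K. (norm (x - k))\<^sup>2)"
  have bdd: "bdd_below ((\<lambda>k. (norm (x - k))\<^sup>2) ` K)"
    by (rule bdd_belowI2[of _ 0]) simp
  have ne: "K \<noteq> {}"
    using sub subspace_0 by blast
  have d_le: "d \<le> (norm (x - k))\<^sup>2" if "k \<in> K" for k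
    unfolding d_def by (rule cINF_lower[OF bdd that])
  have "\<exists>k\<in>K. (norm (x - k))\<^sup>2 < d + inverse (real (Suc n))" for n
    using cINF_less_iff[OF ne bdd, of "d + inverse (real (Suc n))"] by (simp add: d_def)
  then obtain s where s: "\<And>n. s n \<in> K" "\<And>n. (norm (x - s n))\<^sup>2 < d + inverse (real (Suc n))"
    by metis
  have near: "(dist (s m) (s n))\<^sup>2 < 2 * inverse (real (Suc m)) + 2 * inverse (real (Suc n))" for m n
  proof -
    have "(1 / 2) *\<^sub>R (s m + s n) \<in> K"
      by (intro subspace_scale subspace_add sub s)
    then have "4 * d \<le> 4 * (norm (x - (1 / 2) *\<^sub>R (s m + s n)))\<^sup>2"
      using d_le by simp
    also have "\<dots> = (norm (2 *\<^sub>R (x - (1 / 2) *\<^sub>R (s m + s n))))\<^sup>2"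
      by (simp add: power2_eq_square)
    also have "2 *\<^sub>R (x - (1 / 2) *\<^sub>R (s m + s n)) = (x - s m) + (x - s n)"
      by (simp add: algebra_simps scaleR_2)
    finally have "4 * d \<le> (norm ((x - s m) + (x - s n)))\<^sup>2" .
    moreover have "(dist (s m) (s n))\<^sup>2 + (norm ((x - s m) + (x - s n)))\<^sup>2
        = 2 * (norm (x - s m))\<^sup>2 + 2 * (norm (x - s n))\<^sup>2"
      unfolding dist_norm power2_norm_eq_inner inner_diff_left inner_diff_right inner_add_left inner_add_right
      by (simp add: inner_commute)
    ultimately show ?thesis
      using s(2)[of m] s(2)[of n] by linarith
  qed
  have "Cauchy s"
  proof (rule metric_CauchyI)
    fix e :: real assume e: "0 < e"
    then obtain N where N: "inverse (real (Suc N)) < e\<^sup>2 / 4"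
      using reals_Archimedean[of "e\<^sup>2 / 4"] by auto
    have "dist (s m) (s n) < e" if "N \<le> m" "N \<le> n" for m n
    proof -
      have "inverse (real (Suc m)) \<le> inverse (real (Suc N))" "inverse (real (Suc n)) \<le> inverse (real (Suc N))"
        using that by (auto intro!: le_imp_inverse_le)
      then have "(dist (s m) (s n))\<^sup>2 < e\<^sup>2"
        using near[of m n] N by linarith
      then show ?thesis
        using e by (simp add: power_less_imp_less_base)
    qed
    then show "\<exists>M. \<forall>m\<ge>M. \<forall>n\<ge>M. dist (s m) (s n) < e" by blast
  qed
  then obtain p where p: "s \<longlonglongrightarrow> p"
    using Cauchy_convergent convergent_def by blast
  have pK: "p \<in> K"
    by (rule closed_sequentially[OF clo _ p]) (rule s)
  have pd: "(norm (x - p))\<^sup>2 \<le> d + 0"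
  proof (rule LIMSEQ_le)
    show "(\<lambda>n. (norm (x - s n))\<^sup>2) \<longlonglongrightarrow> (norm (x - p))\<^sup>2"
      by (intro tendsto_intros p)
    show "(\<lambda>n. d + inverse (real (Suc n))) \<longlonglongrightarrow> d + 0"
      by (intro tendsto_intros LIMSEQ_inverse_real_of_nat)
  qed (use s(2) less_imp_le in blast)
  have "inner (x - p) k = 0" if k: "k \<in> K" for k
  proof (cases "k = 0")
    case False
    define t where "t = inner (x - p) k / inner k k"
    have kk: "inner k k > 0"
      using False by simp
    have "p + t *\<^sub>R k \<in> K"
      by (intro subspace_add subspace_scale sub pK k)
    from d_le[OF this] pd have "inner (x - p) (x - p) \<le> inner (x - p - t *\<^sub>R k) (x - p - t *\<^sub>R k)"
      unfolding power2_norm_eq_inner by (simp add: diff_diff_eq)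
    also have "\<dots> = inner (x - p) (x - p) - 2 * (t * inner (x - p) k) + t * (t * inner k k)"
      unfolding inner_diff_left[of "x - p"] inner_diff_right[of _ "x - p"] inner_scaleR_left inner_scaleR_right
      by (simp only: inner_commute[of k "x - p"]) (simp add: right_diff_distrib)
    finally have "2 * (t * inner (x - p) k) \<le> t * (t * inner k k)"
      by simp
    moreover have "t * inner k k = inner (x - p) k"
      using kk by (simp add: t_def)
    ultimately have "t * inner (x - p) k \<le> 0"
      by simp
    then have "inner (x - p) k * inner (x - p) k \<le> 0"
      using kk by (simp add: t_def divide_le_0_iff)
    then show ?thesis
      by (metis mult_eq_0_iff order_antisym zero_le_square)
  qed simp
  with pK show ?thesis by blast
qed

definition reduces :: "'a set \<Rightarrow> ('a \<Rightarrow> 'a::real_inner) \<Rightarrow> bool" where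
  "reduces K G \<longleftrightarrow> bounded_linear G \<and> G ` K \<subseteq> K \<and>
     (\<exists>G'. (\<forall>x y. inner (G x) y = inner x (G' y)) \<and> G' ` K \<subseteq> K)"

definition orth_proj :: "'a set \<Rightarrow> 'a \<Rightarrow> 'a::{real_inner, complete_space}" where
  "orth_proj K x = (SOME p. p \<in> K \<and> (\<forall>k\<in>K. inner (x - p) k = 0))"

context
  fixes K :: "'a::{real_inner, complete_space} set"
  assumes sub: "subspace K" and clo: "closed K"
begin

lemma orth_proj_in: "orth_proj K x \<in> K"
  and orth_proj_orth: "k \<in> K \<Longrightarrow> inner (x - orth_proj K x) k = 0"
  using someI_ex[of "\<lambda>p. p \<in> K \<and> (\<forall>k\<in>K. inner (x - p) k = 0)"]
    orthogonal_projection_exists[OF sub clo, of x]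
  unfolding orth_proj_def by blast+

lemma orth_proj_eqI:
  assumes "p \<in> K" "\<And>k. k \<in> K \<Longrightarrow> inner (x - p) k = 0"
  shows "orth_proj K x = p"
proof -
  have k: "p - orth_proj K x \<in> K"
    by (intro subspace_diff sub assms orth_proj_in)
  have "inner (p - orth_proj K x) (p - orth_proj K x) = 0"
    using orth_proj_orth[OF k, of x] assms(2)[OF k] by (simp add: inner_diff_left)
  then show ?thesis by simp
qed

lemma linear_orth_proj: "linear (orth_proj K)"
proof (rule linearI)
  show "orth_proj K (x + y) = orth_proj K x + orth_proj K y" for x y
  proof (rule orth_proj_eqI)
    show "orth_proj K x + orth_proj K y \<in> K"
      by (rule subspace_add[OF sub orth_proj_in orth_proj_in])
    show "inner (x + y - (orth_proj K x + orth_proj K y)) k = 0" if "k \<in> K" for k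
      using orth_proj_orth[OF that, of x] orth_proj_orth[OF that, of y]
      by (simp add: inner_diff_left inner_add_left)
  qed
  show "orth_proj K (r *\<^sub>R x) = r *\<^sub>R orth_proj K x" for r x
  proof (rule orth_proj_eqI)
    show "r *\<^sub>R orth_proj K x \<in> K"
      by (rule subspace_scale[OF sub orth_proj_in])
    show "inner (r *\<^sub>R x - r *\<^sub>R orth_proj K x) k = 0" if "k \<in> K" for k
      using orth_proj_orth[OF that, of x] by (simp add: inner_diff_left)
  qed
qed

lemma orth_proj_adjoint: "inner (orth_proj K x) y = inner x (orth_proj K y)"
  using orth_proj_orth[OF orth_proj_in[of y], of x] orth_proj_orth[OF orth_proj_in[of x], of y]
  by (simp add: inner_diff_left inner_diff_right inner_commute)

lemma norm_orth_proj_le: "norm (orth_proj K x) \<le> norm x"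
proof -
  have "norm (orth_proj K x) * norm (orth_proj K x) = inner x (orth_proj K x)"
    using orth_proj_orth[OF orth_proj_in[of x], of x]
    by (simp add: inner_diff_left flip: power2_norm_eq_inner power2_eq_square)
  also have "\<dots> \<le> norm x * norm (orth_proj K x)"
    by (rule norm_cauchy_schwarz)
  finally show ?thesis
    by (cases "norm (orth_proj K x) = 0") (auto simp: mult_le_cancel_right)
qed

lemma orth_proj_commute:
  assumes "reduces K G"
  shows "G (orth_proj K x) = orth_proj K (G x)"
proof (rule orth_proj_eqI[symmetric])
  obtain G' where G: "linear G" "G ` K \<subseteq> K" "G' ` K \<subseteq> K"
    and adj: "\<And>x y. inner (G x) y = inner x (G' y)"
    using assms bounded_linear.linear by (auto simp: reduces_def)
  show "G (orth_proj K x) \<in> K"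
    using G orth_proj_in by blast
  show "inner (G x - G (orth_proj K x)) k = 0" if "k \<in> K" for k
    using orth_proj_orth[of "G' k" x] G that
    by (simp add: adj image_subset_iff flip: linear_diff[OF \<open>linear G\<close>])
qed

end

text \<open>The Riesz representation of \<open>x \<mapsto> \<langle>A x, y\<rangle>\<close>: the representing vector is a multiple of any vector
\<open>u\<close> that is orthogonal to the kernel of this functional but not in it.\<close>

lemma adjoint_exists:
  fixes A :: "'a \<Rightarrow> 'a::{real_inner, complete_space}"
  assumes A: "bounded_linear A"
  shows "\<exists>B. \<forall>x y. inner (A x) y = inner x (B y)"
proof -
  have "\<exists>z. \<forall>x. inner (A x) y = inner x z" for y
  proof (cases "\<forall>x. inner (A x) y = 0")
    case True
    then show ?thesis by (intro exI[of _ 0]) simp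
  next
    case False
    then obtain x0 where x0: "inner (A x0) y \<noteq> 0" by blast
    interpret A: bounded_linear A by (fact A)
    define K where "K = {x. inner (A x) y = 0}"
    have sub: "subspace K"
      by (simp add: subspace_def K_def A.zero A.add A.scaleR inner_add_left)
    have clo: "closed K"
      unfolding K_def by (intro closed_Collect_eq continuous_intros A.continuous_on)
    define u where "u = x0 - orth_proj K x0"
    have Au: "inner (A u) y \<noteq> 0"
      using x0 orth_proj_in[OF sub clo, of x0] by (simp add: u_def K_def A.diff inner_diff_left)
    then have uu: "inner u u \<noteq> 0"
      by (metis A.zero inner_eq_zero_iff inner_zero_left)
    have "inner (A x) y = inner x ((inner (A u) y / inner u u) *\<^sub>R u)" for x
    proof -
      define t where "t = inner (A x) y / inner (A u) y"
      have "x - t *\<^sub>R u \<in> K"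
        using Au by (simp add: K_def t_def A.diff A.scaleR inner_diff_left)
      then have "inner u (x - t *\<^sub>R u) = 0"
        unfolding u_def by (rule orth_proj_orth[OF sub clo])
      then have "inner x u = t * inner u u"
        by (simp add: inner_diff_right inner_commute)
      then show ?thesis
        using Au uu by (simp add: t_def)
    qed
    then show ?thesis by blast
  qed
  then show ?thesis by metis
qed

text \<open>Let \<open>P\<close> and \<open>Q\<close> be the projections onto \<open>K\<close> and \<open>L\<close>. The hypotheses say that \<open>K\<close> is the
orthogonal complement of the kernel of \<open>Q P\<close>, and \<open>L\<close> that of the kernel of \<open>P Q\<close>. Hence the
polar part of \<open>Q P\<close> is isometric on \<open>K\<close>, and that of \<open>P Q\<close> inverts it. Whatever is reduced by
both spaces commutes with \<open>P\<close> and \<open>Q\<close>, and so with the polar part.\<close>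

lemma generic_position_isometry:
  fixes K L :: "'a::{real_inner, complete_space} set"
  assumes K: "subspace K" "closed K" and L: "subspace L" "closed L"
    and KL: "\<And>x. x \<in> K \<Longrightarrow> (\<And>y. y \<in> L \<Longrightarrow> inner x y = 0) \<Longrightarrow> x = 0"
    and LK: "\<And>x. x \<in> L \<Longrightarrow> (\<And>y. y \<in> K \<Longrightarrow> inner x y = 0) \<Longrightarrow> x = 0"
  obtains Z where "linear Z" "Z ` K = L" "\<And>x. x \<in> K \<Longrightarrow> norm (Z x) = norm x"
    "\<forall>G x. reduces K G \<and> reduces L G \<longrightarrow> Z (G x) = G (Z x)"
proof -
  define P Q where "P = orth_proj K" and "Q = orth_proj L"
  define R S where "R = Q \<circ> P" and "S = P \<circ> Q"
  interpret contraction_pair R S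
  proof (rule contraction_pair.intro)
    show "linear R" "linear S"
      unfolding R_def S_def P_def Q_def by (intro linear_compose linear_orth_proj K L)+
    show "inner (R x) y = inner x (S y)" for x y
      by (simp add: R_def S_def P_def Q_def orth_proj_adjoint K L)
    show "norm (R x) \<le> norm x" for x
      using order_trans[OF norm_orth_proj_le[OF L] norm_orth_proj_le[OF K]]
      by (simp add: R_def P_def Q_def)
  qed
  have orth: "inner x k = 0"
    if "subspace A" "closed A" "subspace B" "closed B"
      and AB: "\<And>x. x \<in> A \<Longrightarrow> (\<And>y. y \<in> B \<Longrightarrow> inner x y = 0) \<Longrightarrow> x = 0"
      and "x \<in> A" "orth_proj B (orth_proj A k) = 0" for A B x k
  proof -
    have "orth_proj A k = 0"
    proof (rule AB)
      show "orth_proj A k \<in> A"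
        by (rule orth_proj_in) fact+
      show "inner (orth_proj A k) y = 0" if "y \<in> B" for y
        using orth_proj_orth[OF \<open>subspace B\<close> \<open>closed B\<close> that, of "orth_proj A k"]
        by (simp add: \<open>orth_proj B (orth_proj A k) = 0\<close>)
    qed
    then show ?thesis
      using orth_proj_orth[OF \<open>subspace A\<close> \<open>closed A\<close> \<open>x \<in> A\<close>, of k] by (simp add: inner_commute)
  qed
  have kerR: "inner x k = 0" if "x \<in> K" "R k = 0" for x k
    by (rule orth[OF K L KL that(1)]) (use that(2) in \<open>simp_all add: R_def P_def Q_def\<close>)
  have kerS: "inner x k = 0" if "x \<in> L" "S k = 0" for x k
    by (rule orth[OF L K LK that(1)]) (use that(2) in \<open>simp_all add: S_def P_def Q_def\<close>)
  have ZL: "polar R S x \<in> L" for x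
    by (rule polar_in_closed_subspace[OF L]) (simp add: R_def Q_def orth_proj_in L)
  have ZK: "polar S R x \<in> K" for x
    by (rule contraction_pair.polar_in_closed_subspace[OF contraction_pair_dual K])
      (simp add: S_def P_def orth_proj_in K)
  show ?thesis
  proof (rule that)
    show "linear (polar R S)" by (rule linear_polar)
    show "norm (polar R S x) = norm x" if "x \<in> K" for x
      by (rule norm_polar) (rule kerR[OF that])
    show "polar R S ` K = L"
    proof
      show "polar R S ` K \<subseteq> L" using ZL by blast
      show "L \<subseteq> polar R S ` K"
      proof
        fix y assume "y \<in> L"
        then have "y = polar R S (polar S R y)"
          using contraction_pair.polar_dual_polar[OF contraction_pair_dual, of y] kerS by simp
        then show "y \<in> polar R S ` K" using ZK by blast
      qed
    qed
    show "\<forall>G x. reduces K G \<and> reduces L G \<longrightarrow> polar R S (G x) = G (polar R S x)"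
    proof (intro allI impI)
      fix G x assume G: "reduces K G \<and> reduces L G"
      have P: "G (P x) = P (G x)" and Q: "G (Q x) = Q (G x)" for x
        unfolding P_def Q_def using G K L by (simp_all add: orth_proj_commute)
      have "bounded_linear G"
        using G by (simp add: reduces_def)
      then show "polar R S (G x) = G (polar R S x)"
        by (rule polar_commute[symmetric]) (simp_all add: R_def S_def P Q)
    qed
  qed
qed

section \<open>The square root of a unitary operator\<close>

text \<open>\<open>V'\<close> is the inverse of the unitary \<open>V\<close>, and \<open>J\<close> is the multiplication by the imaginary unit.\<close>

locale unitary_with_complex_structure =
  fixes V V' J :: "'a \<Rightarrow> 'a::{real_inner, complete_space}"
  assumes linV: "linear V" and linV': "linear V'" and linJ: "linear J"
    and VV': "V (V' x) = x" and V'V: "V' (V x) = x"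
    and V_adj: "inner (V x) y = inner x (V' y)"
    and JJ: "J (J x) = - x" and J_iso: "inner (J x) (J y) = inner x y"
    and JV: "J (V x) = V (J x)"
begin

definition R where "R x = (1 / 2) *\<^sub>R (x + V x)"
definition S where "S x = (1 / 2) *\<^sub>R (x + V' x)"

abbreviation "Z \<equiv> polar R S"
abbreviation "Z' \<equiv> polar S R"

text \<open>\<open>Z\<close> is the polar part of \<open>(1 + V) / 2\<close>. For \<open>z\<close> on the unit circle other than \<open>-1\<close>, the number
\<open>(1 + z) / \<bar>1 + z\<bar>\<close> is the square root of \<open>z\<close> with positive real part, so \<open>Z\<^sup>2 = V\<close> off the
eigenspace of \<open>-1\<close>. \<open>E\<close> is the projection onto this eigenspace; there \<open>J\<close> is a square root.\<close>

definition E where "E x = x - Z' (Z x)"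

definition usqrt where "usqrt x = Z x + J (E x)"

definition usqrt_approx where
  "usqrt_approx N x = polar_approx R S N x + J (x - polar_approx S R N (polar_approx R S N x))"

lemma norm_V: "norm (V x) = norm x"
  using V_adj[of x "V x"] by (simp add: V'V norm_eq)

sublocale contraction_pair R S
proof (rule contraction_pair.intro)
  show "linear R" "linear S"
    unfolding R_def S_def
    by (intro linear_compose_scale_right linear_compose_add linear_ident linV linV')+
  show "inner (R x) y = inner x (S y)" for x y
    by (simp add: R_def S_def inner_add_left inner_add_right V_adj)
  show "norm (R x) \<le> norm x" for x
    using norm_triangle_ineq[of x "V x"] by (simp add: R_def norm_V)
qed

sublocale dual: contraction_pair S R
  by (rule contraction_pair_dual)

lemma J_adj: "inner (J x) y = - inner x (J y)"
  using J_iso[of x "J y"] by (simp add: JJ)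

lemma JV': "J (V' x) = V' (J x)"
  by (metis JV V'V VV')

lemma bounded_linear_J: "bounded_linear J"
proof (rule bounded_linear_intro)
  show "norm (J x) \<le> norm x * 1" for x
    by (simp add: norm_eq_sqrt_inner J_iso)
qed (simp_all add: linear_add linear_scale linJ)

lemma bounded_linear_V: "bounded_linear V"
  by (rule bounded_linear_intro[where K = 1]) (simp_all add: linear_add linear_scale linV norm_V)

lemma R_eq_V_S: "R x = V (S x)"
  by (simp add: R_def S_def linear_add linear_scale linV VV' add.commute)

lemma half_sum_relations:
  "S (R x) = (1 / 2) *\<^sub>R (R x + S x)" "R (S x) = S (R x)" "J (R x) = R (J x)" "J (S x) = S (J x)"
proof -
  show "S (R x) = (1 / 2) *\<^sub>R (R x + S x)" "R (S x) = S (R x)"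
    by (simp_all add: R_def S_def linear_add linear_scale linV linV' VV' V'V algebra_simps)
  show "J (R x) = R (J x)" "J (S x) = S (J x)"
    by (simp_all add: R_def S_def linear_add linear_scale linJ JV JV')
qed

lemma defect_dual: "defect S R = defect R S"
  by (simp add: fun_eq_iff defect_def half_sum_relations)

text \<open>The polar form of \<open>1 + V = V (1 + V\<^sup>*)\<close>.\<close>

lemma Z_eq_V_Z': "Z x = V (Z' x)"
proof (rule LIMSEQ_unique)
  show "(\<lambda>N. polar_approx R S N x) \<longlonglongrightarrow> Z x"
    by (rule LIMSEQ_polar)
  have "polar_approx R S N x = V (polar_approx S R N x)" for N
    unfolding polar_approx_def defect_dual
    by (simp add: linear_sum[OF linV] linear_scale[OF linV] R_eq_V_S)
  then show "(\<lambda>N. polar_approx R S N x) \<longlonglongrightarrow> V (Z' x)"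
    by (simp add: bounded_linear.tendsto[OF bounded_linear_V] dual.LIMSEQ_polar)
qed

lemma R_E: "R (E x) = 0"
  unfolding E_def by (rule polar_dual_polar_diff_kernel)

lemma kernel_iff: "R x = 0 \<longleftrightarrow> S x = 0"
  by (metis R_eq_V_S V'V linear_0 linV linV')

lemma Z_E: "Z (E x) = 0"
  by (rule polar_kernel) (rule R_E)

lemma Z'_E: "Z' (E x) = 0"
  by (rule dual.polar_kernel) (simp add: R_E flip: kernel_iff)

lemma E_E: "E (E x) = E x"
  by (simp add: E_def[of "E x"] Z_E linear_0[OF dual.linear_polar])

lemma V_E: "V (E x) = - E x"
  using R_E[of x] by (simp add: R_def add_eq_0_iff add.commute)

lemma J_Z: "J (Z x) = Z (J x)"
  by (rule polar_commute[OF bounded_linear_J]) (simp_all add: half_sum_relations)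

lemma J_Z': "J (Z' x) = Z' (J x)"
  by (rule dual.polar_commute[OF bounded_linear_J]) (simp_all add: half_sum_relations)

lemma J_E: "J (E x) = E (J x)"
  by (simp add: E_def linear_diff[OF linJ] J_Z J_Z')

lemma E_adj: "inner (E x) y = inner x (E y)"
  by (simp add: E_def inner_diff_left inner_diff_right polar_adjoint dual.polar_adjoint)

lemma E_Z: "E (Z x) = 0"
proof -
  have "inner (Z x) k = 0" if "R k = 0" for k
    using that by (simp add: polar_adjoint dual.polar_kernel kernel_iff)
  then show ?thesis
    by (simp add: E_def polar_dual_polar)
qed

lemma Z_Z: "Z (Z x) = V x + E x"
proof -
  have "Z (Z x) = V (x - E x)"
    by (simp add: Z_eq_V_Z'[of "Z x"] E_def)
  then show ?thesis
    by (simp add: linear_diff[OF linV] V_E)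
qed

lemma linear_E: "linear E"
  unfolding E_def
  by (intro linear_compose_sub linear_ident linear_compose[OF linear_polar dual.linear_polar, unfolded o_def])

lemma linear_usqrt: "linear usqrt"
  unfolding usqrt_def
  by (intro linear_compose_add linear_polar linear_compose[OF linear_E linJ, unfolded o_def])

lemma usqrt_usqrt: "usqrt (usqrt x) = V x"
proof -
  have "Z (J (E x)) = 0" "E (J (E x)) = J (E x)"
    by (simp_all add: Z_E E_E linear_0[OF linJ] flip: J_Z J_E)
  then show ?thesis
    by (simp add: usqrt_def linear_add[OF linear_polar] linear_add[OF linear_E] E_Z Z_Z JJ)
qed

lemma usqrt_isometric: "inner (usqrt x) (usqrt y) = inner x y"
proof -
  have 1: "inner (Z x) (Z y) = inner x y - inner x (E y)" for x y
    by (simp add: polar_adjoint E_def inner_diff_right)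
  have 2: "inner (Z x) (J (E y)) = 0" for x y
    by (simp add: polar_adjoint Z'_E linear_0[OF linJ] flip: J_Z')
  have 3: "inner (J (E x)) (J (E y)) = inner x (E y)"
    by (simp add: J_iso E_adj E_E)
  show ?thesis
    using 2[of x y] 2[of y x] by (simp add: usqrt_def inner_add_left inner_add_right 1 3 inner_commute)
qed

text \<open>The Hermitian part of \<open>R\<close> is \<open>R\<^sup>* R\<close>, and \<open>R\<close> commutes with \<open>X\<close>.\<close>

lemma R_pow_inner: "inner (R ((X ^^ n) x)) x = gap x n"
proof -
  have comm: "X (R y) = R (X y)" for y
    by (simp add: defect_def linear_diff[OF linR] half_sum_relations(2))
  have pow: "(X ^^ n) (R y) = R ((X ^^ n) y)" for y n
    by (induction n arbitrary: y) (simp_all add: comm)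
  have "inner (S ((X ^^ n) x)) x = inner (R ((X ^^ n) x)) x"
    using dual.adj defect_symmetric[of n x "R x"] by (simp add: pow inner_commute)
  then have "inner (R ((X ^^ n) x)) x = inner (S (R ((X ^^ n) x))) x"
    by (simp add: half_sum_relations(1) inner_add_left)
  also have "\<dots> = inner (R ((X ^^ n) x)) (R ((X ^^ 0) x))"
    by (simp add: dual.adj)
  finally show ?thesis
    unfolding inner_R_pow_pow by (simp add: gap_def)
qed

text \<open>By the preceding identity each term of the series for \<open>\<langle>Z x, x\<rangle>\<close> is nonnegative, and the first
term is the left-hand side.\<close>

lemma Z_inner_ge: "(norm (R x))\<^sup>2 \<le> inner (Z x) x"
proof (rule LIMSEQ_le_const)
  show "(\<lambda>N. inner (polar_approx R S N x) x) \<longlonglongrightarrow> inner (Z x) x"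
    by (intro tendsto_intros LIMSEQ_polar)
  have "(norm (R x))\<^sup>2 \<le> inner (polar_approx R S N x) x" if "1 \<le> N" for N
  proof -
    have "(norm (R x))\<^sup>2 = gap x 0"
      using inner_R_pow_pow[of 0 x 0] by (simp add: gap_def power2_norm_eq_inner)
    also have "\<dots> = (\<Sum>n\<in>{0}. invsqrt_coeff n * gap x n)"
      by (simp add: invsqrt_coeff_0)
    also have "\<dots> \<le> (\<Sum>n<N. invsqrt_coeff n * gap x n)"
      using that by (intro sum_mono2) (auto simp: invsqrt_coeff_nonneg gap_nonneg)
    also have "\<dots> = inner (polar_approx R S N x) x"
      by (simp add: polar_approx_def inner_sum_left R_pow_inner)
    finally show ?thesis .
  qed
  then show "\<exists>N. \<forall>n\<ge>N. (norm (R x))\<^sup>2 \<le> inner (polar_approx R S n x) x" by blast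
qed

text \<open>The numerical range of the principal square root lies in the convex hull of the half-open arc from \<open>-\<i>\<close>
(excluded) to \<open>\<i>\<close> (included), which does not contain \<open>0\<close>. The two hypotheses are the vanishing of
the real and the imaginary part of the complex inner product. The real part forces \<open>x\<close> into the
eigenspace of \<open>-1\<close>, where the square root is \<open>J\<close> and the imaginary part is the squared norm.\<close>

lemma usqrt_numerical_range:
  assumes "inner (usqrt x) x = 0" "inner (J (usqrt x)) x = 0"
  shows "x = 0"
proof -
  have "inner (J y) y = 0" for y
    using J_adj[of y y] by (simp add: inner_commute)
  moreover have "inner (J (E x)) x = inner (J (E x)) (E x)"
    by (metis E_E E_adj J_E)
  ultimately have "inner (usqrt x) x = inner (Z x) x"
    by (simp add: usqrt_def inner_add_left)
  then have "(norm (R x))\<^sup>2 \<le> 0"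
    using Z_inner_ge[of x] assms(1) by simp
  then have "R x = 0" by simp
  then have "Z x = 0" by (rule polar_kernel)
  then have "usqrt x = J x"
    by (simp add: usqrt_def E_def linear_0[OF dual.linear_polar])
  with assms(2) show ?thesis
    by (simp add: JJ)
qed

lemma LIMSEQ_usqrt: "(\<lambda>N. usqrt_approx N x) \<longlonglongrightarrow> usqrt x"
proof -
  have small: "(\<lambda>N. polar_approx S R N (polar_approx R S N x - Z x)) \<longlonglongrightarrow> 0"
  proof (rule Lim_null_comparison)
    show "\<forall>\<^sub>F N in sequentially. norm (polar_approx S R N (polar_approx R S N x - Z x))
        \<le> norm (polar_approx R S N x - Z x)"
      by (simp add: dual.norm_polar_approx_le)
    show "(\<lambda>N. norm (polar_approx R S N x - Z x)) \<longlonglongrightarrow> 0"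
      using LIMSEQ_polar[of x] LIM_zero tendsto_norm_zero by blast
  qed
  have "(\<lambda>N. polar_approx S R N (polar_approx R S N x - Z x) + polar_approx S R N (Z x)) \<longlonglongrightarrow> 0 + Z' (Z x)"
    by (intro tendsto_add small dual.LIMSEQ_polar)
  then have "(\<lambda>N. polar_approx S R N (polar_approx R S N x)) \<longlonglongrightarrow> Z' (Z x)"
    by (simp flip: linear_add[OF dual.linear_polar_approx])
  from tendsto_add[OF LIMSEQ_polar
      bounded_linear.tendsto[OF bounded_linear_J tendsto_diff[OF tendsto_const this]]]
  show ?thesis
    unfolding usqrt_approx_def usqrt_def E_def .
qed

end

section \<open>Completeness of the space of square-integrable functions\<close>

lemma L2_obtain_rep:
  obtains f where "square_integrable f" "F = abs_L2 f"
proof -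
  have "L2_rel (rep_L2 F) (rep_L2 F)" "abs_L2 (rep_L2 F) = F"
    by (rule Quotient3_rep_reflp[OF Quotient3_L2], rule Quotient3_abs_rep[OF Quotient3_L2])
  then show ?thesis
    using that[of "rep_L2 F"] by (simp add: L2_rel_def)
qed

lemma dist_abs_L2:
  assumes f: "square_integrable f" and g: "square_integrable g"
  shows "ennreal ((dist (abs_L2 f) (abs_L2 g))\<^sup>2) = (\<integral>\<^sup>+x. ennreal ((cmod (f x - g x))\<^sup>2) \<partial>lborel)"
proof -
  define h where "h x = f x - g x" for x
  have h: "square_integrable h"
    using square_integrable_add[OF f square_integrable_cmult[OF g, of "- 1"]] by (simp add: h_def[abs_def])
  have refl: "L2_rel f f" "L2_rel g g" "L2_rel h h" "L2_rel (\<lambda>x. - g x) (\<lambda>x. - g x)"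
    using f g h square_integrable_cmult[OF g, of "- 1"] by (simp_all add: L2_rel_def)
  have "abs_L2 f - abs_L2 g = abs_L2 h"
    using refl by (simp add: minus_L2_def uminus_L2.abs_eq plus_L2.abs_eq h_def[abs_def])
  then have "(dist (abs_L2 f) (abs_L2 g))\<^sup>2 = Re (cinner (abs_L2 h) (abs_L2 h))"
    by (simp add: dist_norm power2_norm_eq_inner inner_L2_def)
  also have "\<dots> = (\<integral>x. (cmod (h x))\<^sup>2 \<partial>lborel)"
    using refl by (simp add: cinner.abs_eq Re_cinner_self)
  finally show ?thesis
    using h by (simp add: square_integrable_def nn_integral_eq_integral h_def)
qed

text \<open>Weighting with \<open>4\<^sup>n\<close> keeps the sum of the squared norms finite, so almost everywhere the terms
\<open>4\<^sup>n \<bar>h\<^sub>n(x)\<bar>\<^sup>2\<close> tend to 0 and \<open>\<bar>h\<^sub>n(x)\<bar>\<close> is eventually below \<open>2\<^sup>-\<^sup>n\<close>.\<close>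

lemma AE_summable_of_geometric_L2_bound:
  fixes h :: "nat \<Rightarrow> real \<Rightarrow> complex"
  assumes [measurable]: "\<And>n. h n \<in> borel_measurable lborel"
    and bound: "\<And>n. (\<integral>\<^sup>+x. ennreal ((cmod (h n x))\<^sup>2) \<partial>lborel) \<le> ennreal ((1 / 16) ^ n)"
  shows "AE x in lborel. summable (\<lambda>n. h n x)"
proof -
  have "(\<integral>\<^sup>+x. (\<Sum>n. ennreal (4 ^ n * (cmod (h n x))\<^sup>2)) \<partial>lborel)
      = (\<Sum>n. \<integral>\<^sup>+x. ennreal (4 ^ n * (cmod (h n x))\<^sup>2) \<partial>lborel)"
    by (rule nn_integral_suminf) measurable
  also have "\<dots> \<le> (\<Sum>n. ennreal ((1 / 4) ^ n))"
  proof (rule suminf_le)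
    fix n
    have "(\<integral>\<^sup>+x. ennreal (4 ^ n * (cmod (h n x))\<^sup>2) \<partial>lborel)
        = ennreal (4 ^ n) * (\<integral>\<^sup>+x. ennreal ((cmod (h n x))\<^sup>2) \<partial>lborel)"
      by (simp add: ennreal_mult nn_integral_cmult)
    also have "\<dots> \<le> ennreal (4 ^ n) * ennreal ((1 / 16) ^ n)"
      by (intro mult_left_mono bound) simp
    also have "\<dots> = ennreal ((1 / 4) ^ n)"
      by (simp add: flip: ennreal_mult power_mult_distrib)
    finally show "(\<integral>\<^sup>+x. ennreal (4 ^ n * (cmod (h n x))\<^sup>2) \<partial>lborel) \<le> ennreal ((1 / 4) ^ n)" .
  qed simp_all
  also have "\<dots> = ennreal (\<Sum>n. (1 / 4) ^ n)"
    by (rule suminf_ennreal2) (simp_all add: summable_geometric)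
  also have "\<dots> < \<infinity>" by simp
  finally have "AE x in lborel. (\<Sum>n. ennreal (4 ^ n * (cmod (h n x))\<^sup>2)) \<noteq> \<infinity>"
    by (intro nn_integral_PInf_AE) (simp_all add: less_top)
  then show ?thesis
  proof eventually_elim
    fix x assume "(\<Sum>n. ennreal (4 ^ n * (cmod (h n x))\<^sup>2)) \<noteq> \<infinity>"
    then have "summable (\<lambda>n. 4 ^ n * (cmod (h n x))\<^sup>2)"
      by (intro summable_suminf_not_top) simp_all
    then have "(\<lambda>n. 4 ^ n * (cmod (h n x))\<^sup>2) \<longlonglongrightarrow> 0"
      by (rule summable_LIMSEQ_zero)
    then have "\<forall>\<^sub>F n in sequentially. 4 ^ n * (cmod (h n x))\<^sup>2 < 1"
      by (rule order_tendstoD) simp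
    then have "\<forall>\<^sub>F n in sequentially. norm (h n x) \<le> (1 / 2) ^ n"
    proof eventually_elim
      fix n assume "4 ^ n * (cmod (h n x))\<^sup>2 < 1"
      also have "4 ^ n * (cmod (h n x))\<^sup>2 = (2 ^ n * cmod (h n x))\<^sup>2"
        by (simp add: power_mult_distrib power2_eq_square flip: power_mult_distrib)
      finally have "2 ^ n * cmod (h n x) < 1"
        using power2_less_imp_less[of "2 ^ n * cmod (h n x)" 1] by simp
      then show "norm (h n x) \<le> (1 / 2) ^ n"
        by (simp add: power_divide field_simps)
    qed
    then show "summable (\<lambda>n. h n x)"
      by (rule summable_comparison_test_ev) (simp add: summable_geometric)
  qed
qed

text \<open>Riesz-Fischer: a rapidly converging subsequence converges almost everywhere by the preceding lemma,
and Fatou's lemma turns the pointwise limit into a limit in the norm.\<close>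

instance L2 :: complete_space
proof
  fix u :: "nat \<Rightarrow> L2" assume "Cauchy u"
  have "\<exists>N. \<forall>m\<ge>N. \<forall>n\<ge>N. dist (u m) (u n) < (1 / 4) ^ k" for k
    using metric_CauchyD[OF \<open>Cauchy u\<close>, of "(1 / 4) ^ k"] by simp
  then obtain N where N: "\<And>k m n. N k \<le> m \<Longrightarrow> N k \<le> n \<Longrightarrow> dist (u m) (u n) < (1 / 4) ^ k"
    by metis
  \<comment> \<open>summing the thresholds gives a strictly increasing sequence that dominates them\<close>
  define r where "r n = (\<Sum>i\<le>n. Suc (N i))" for n
  have r: "strict_mono r"
    by (simp add: strict_mono_Suc_iff r_def)
  have rN: "N n \<le> r n" for n
    using member_le_sum[of n "{..n}" "\<lambda>i. Suc (N i)"] by (simp add: r_def)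
  have fast: "dist (u (r (Suc n))) (u (r n)) < (1 / 4) ^ n" for n
    using rN[of n] strict_mono_less[OF r, of n "Suc n"] by (intro N) simp_all
  have "\<exists>f. square_integrable f \<and> u (r n) = abs_L2 f" for n
    using L2_obtain_rep by metis
  then obtain g where g: "\<And>n. square_integrable (g n)" and ug: "\<And>n. u (r n) = abs_L2 (g n)"
    by metis
  have [measurable]: "g n \<in> borel_measurable borel" for n
    using g[of n] by (simp add: square_integrable_def)
  have "AE x in lborel. summable (\<lambda>n. g (Suc n) x - g n x)"
  proof (rule AE_summable_of_geometric_L2_bound)
    fix n
    have "(dist (u (r (Suc n))) (u (r n)))\<^sup>2 \<le> ((1 / 4) ^ n)\<^sup>2"
      using fast[of n] by (intro power_mono) simp_all
    then have "ennreal ((dist (u (r (Suc n))) (u (r n)))\<^sup>2) \<le> ennreal (((1 / 4) ^ n)\<^sup>2)"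
      by (rule ennreal_leI)
    moreover have "((1 / 4) ^ n)\<^sup>2 = (1 / 16 :: real) ^ n"
      by (simp add: power2_eq_square flip: power_mult_distrib)
    ultimately show "(\<integral>\<^sup>+x. ennreal ((cmod (g (Suc n) x - g n x))\<^sup>2) \<partial>lborel) \<le> ennreal ((1 / 16) ^ n)"
      by (simp only: ug dist_abs_L2[OF g g])
  qed measurable
  define G where "G x = lim (\<lambda>n. g n x)" for x
  have [measurable]: "G \<in> borel_measurable borel"
    unfolding G_def by measurable
  have AE_lim: "AE x in lborel. (\<lambda>n. g n x) \<longlonglongrightarrow> G x"
    using \<open>AE x in lborel. summable (\<lambda>n. g (Suc n) x - g n x)\<close>
  proof eventually_elim
    fix x assume "summable (\<lambda>n. g (Suc n) x - g n x)"
    then have "(\<lambda>n. \<Sum>i<n. g (Suc i) x - g i x) \<longlonglongrightarrow> (\<Sum>n. g (Suc n) x - g n x)"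
      by (rule summable_LIMSEQ)
    then have "(\<lambda>n. g 0 x + (g n x - g 0 x)) \<longlonglongrightarrow> g 0 x + (\<Sum>n. g (Suc n) x - g n x)"
      unfolding sum_lessThan_telescope[of "\<lambda>n. g n x"] by (intro tendsto_intros)
    then show "(\<lambda>n. g n x) \<longlonglongrightarrow> G x"
      unfolding G_def by (simp add: convergent_def flip: convergent_LIMSEQ_iff) blast
  qed
  have fatou: "(\<integral>\<^sup>+x. ennreal ((cmod (G x - g m x))\<^sup>2) \<partial>lborel) \<le> ennreal (((1 / 4) ^ k)\<^sup>2)" if "k \<le> m" for k m
  proof -
    have "(\<integral>\<^sup>+x. ennreal ((cmod (G x - g m x))\<^sup>2) \<partial>lborel)
        = (\<integral>\<^sup>+x. liminf (\<lambda>n. ennreal ((cmod (g n x - g m x))\<^sup>2)) \<partial>lborel)"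
    proof (rule nn_integral_cong_AE)
      show "AE x in lborel. ennreal ((cmod (G x - g m x))\<^sup>2) = liminf (\<lambda>n. ennreal ((cmod (g n x - g m x))\<^sup>2))"
        using AE_lim
      proof eventually_elim
        fix x assume "(\<lambda>n. g n x) \<longlonglongrightarrow> G x"
        then have "(\<lambda>n. ennreal ((cmod (g n x - g m x))\<^sup>2)) \<longlonglongrightarrow> ennreal ((cmod (G x - g m x))\<^sup>2)"
          by (intro tendsto_ennrealI tendsto_intros)
        then show "ennreal ((cmod (G x - g m x))\<^sup>2) = liminf (\<lambda>n. ennreal ((cmod (g n x - g m x))\<^sup>2))"
          by (intro lim_imp_Liminf[symmetric]) simp_all
      qed
    qed
    also have "\<dots> \<le> liminf (\<lambda>n. \<integral>\<^sup>+x. ennreal ((cmod (g n x - g m x))\<^sup>2) \<partial>lborel)"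
      by (rule nn_integral_liminf) measurable
    also have "\<dots> \<le> ennreal (((1 / 4) ^ k)\<^sup>2)"
    proof (rule Liminf_le)
      have "(\<integral>\<^sup>+x. ennreal ((cmod (g n x - g m x))\<^sup>2) \<partial>lborel) \<le> ennreal (((1 / 4) ^ k)\<^sup>2)" if "k \<le> n" for n
      proof -
        have "N k \<le> r n" "N k \<le> r m"
          using rN[of k] strict_mono_less_eq[OF r] that \<open>k \<le> m\<close> by (meson order_trans)+
        then have "(dist (u (r n)) (u (r m)))\<^sup>2 \<le> ((1 / 4) ^ k)\<^sup>2"
          using N[of k "r n" "r m"] by (intro power_mono) simp_all
        then show ?thesis
          unfolding dist_abs_L2[OF g g, symmetric] ug[symmetric] by (rule ennreal_leI)
      qed
      then show "\<forall>\<^sub>F n in sequentially. (\<integral>\<^sup>+x. ennreal ((cmod (g n x - g m x))\<^sup>2) \<partial>lborel) \<le> ennreal (((1 / 4) ^ k)\<^sup>2)"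
        by (rule eventually_sequentiallyI)
    qed simp
    finally show ?thesis .
  qed
  have "square_integrable (\<lambda>x. G x - g 0 x)"
  proof -
    have "(\<integral>\<^sup>+x. ennreal (norm ((cmod (G x - g 0 x))\<^sup>2)) \<partial>lborel) < \<infinity>"
      using fatou[of 0 0] by (simp add: order_le_less_trans)
    then show ?thesis
      by (simp add: square_integrable_def integrable_iff_bounded)
  qed
  from square_integrable_add[OF this g[of 0]] have G: "square_integrable G"
    by simp
  have "(u \<circ> r) \<longlonglongrightarrow> abs_L2 G"
  proof (rule metric_LIMSEQ_I)
    fix e :: real assume "0 < e"
    then obtain k where k: "(1 / 4) ^ k < e"
      using real_arch_pow_inv[of e "1 / 4"] by auto
    have "dist ((u \<circ> r) n) (abs_L2 G) < e" if "k \<le> n" for n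
    proof -
      have "ennreal ((dist (abs_L2 G) (abs_L2 (g n)))\<^sup>2) \<le> ennreal (((1 / 4) ^ k)\<^sup>2)"
        unfolding dist_abs_L2[OF G g] by (rule fatou[OF that])
      then have "(dist (abs_L2 G) (abs_L2 (g n)))\<^sup>2 \<le> ((1 / 4) ^ k)\<^sup>2"
        by (subst (asm) ennreal_le_iff) simp_all
      then have "dist (abs_L2 G) (abs_L2 (g n)) \<le> (1 / 4) ^ k"
        by (rule power2_le_imp_le) simp
      then show ?thesis
        using k by (simp add: ug dist_commute)
    qed
    then show "\<exists>no. \<forall>n\<ge>no. dist ((u \<circ> r) n) (abs_L2 G) < e" by blast
  qed
  then have "u \<longlonglongrightarrow> abs_L2 G"
    by (rule Cauchy_converges_subseq[OF \<open>Cauchy u\<close> r])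
  then show "convergent u"
    by (auto simp: convergent_def)
qed

section \<open>The complex structure and unitary operators\<close>

lemma subspace_closure:
  fixes S :: "'a::real_normed_vector set"
  assumes S: "subspace S"
  shows "subspace (closure S)"
  unfolding subspace_def
proof (intro conjI ballI allI)
  show "0 \<in> closure S"
    using subspace_0[OF S] closure_subset by blast
  fix x assume "x \<in> closure S"
  then obtain f where f: "\<And>n. f n \<in> S" "f \<longlonglongrightarrow> x"
    unfolding closure_sequential by blast
  show "c *\<^sub>R x \<in> closure S" for c
    unfolding closure_sequential
    using f by (intro exI[of _ "\<lambda>n. c *\<^sub>R f n"]) (auto intro: subspace_scale[OF S] tendsto_intros)
  fix y assume "y \<in> closure S"
  then obtain g where g: "\<And>n. g n \<in> S" "g \<longlonglongrightarrow> y"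
    unfolding closure_sequential by blast
  show "x + y \<in> closure S"
    unfolding closure_sequential
    using f g by (intro exI[of _ "\<lambda>n. f n + g n"]) (auto intro: subspace_add[OF S] tendsto_intros)
qed

abbreviation J :: "L2 \<Rightarrow> L2" where "J f \<equiv> \<i> *\<^sub>C f"

lemma scaleC_decompose: "c *\<^sub>C f = Re c *\<^sub>R f + Im c *\<^sub>R J f"
proof -
  have "c *\<^sub>C f = (of_real (Re c) + of_real (Im c) * \<i>) *\<^sub>C f"
    by (simp add: complex_eq[symmetric] mult.commute)
  then show ?thesis
    by (simp only: L2.scale_left_distrib scaleR_L2_def L2.scale_scale)
qed

lemma J_J: "J (J f) = - f"
  by (simp add: L2.scale_minus_left)

lemma linear_J: "linear J"
  by (rule linearI) (simp_all add: L2.scale_right_distrib scaleR_L2_def mult.commute)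

lemma cinner_eq: "cinner f g = Complex (inner f g) (- inner (J f) g)"
  by (simp add: complex_eq_iff inner_L2_def cinner_scaleC_left)

lemma cinner_scaleC_right: "cinner f (c *\<^sub>C g) = cnj c * cinner f g"
proof -
  have "cinner f (c *\<^sub>C g) = cnj (cinner (c *\<^sub>C g) f)"
    by (rule cinner_cnj)
  also have "\<dots> = cnj c * cnj (cinner g f)"
    by (simp add: cinner_scaleC_left)
  also have "cnj (cinner g f) = cinner f g"
    by (rule cinner_cnj[symmetric])
  finally show ?thesis .
qed

lemma J_isometric: "inner (J f) (J g) = inner f g"
  by (simp add: inner_L2_def cinner_scaleC_left cinner_scaleC_right)

lemma J_skew: "inner (J f) g = - inner f (J g)"
  using J_isometric[of f "J g"] by (simp add: J_J del: L2.scale_scale)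

lemma bounded_linear_J: "bounded_linear J"
  by (rule bounded_linear_intro[where K = 1])
    (simp_all add: linear_add[OF linear_J] linear_scale[OF linear_J] norm_eq_sqrt_inner J_isometric)

lemma bounded_opI:
  assumes "bounded_linear A" "\<And>f. A (J f) = J (A f)"
  shows "bounded_op A"
proof -
  interpret A: bounded_linear A by (fact assms)
  have "A (c *\<^sub>C f) = c *\<^sub>C A f" for c f
    unfolding scaleC_decompose[of c] by (simp only: A.add A.scaleR assms(2))
  then show ?thesis
    using assms by (simp add: bounded_op_def)
qed

lemma bounded_opD:
  assumes "bounded_op A"
  shows "bounded_linear A" "linear A" "A (c *\<^sub>C f) = c *\<^sub>C A f"
  using assms bounded_linear.linear by (auto simp: bounded_op_def)

lemma unitary_opI:
  assumes lin: "linear A" and J: "\<And>f. A (J f) = J (A f)"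
    and iso: "\<And>f g. inner (A f) (A g) = inner f g" and "surj A"
  shows "unitary_op A"
proof -
  have "bounded_linear A"
    by (rule bounded_linear_intro[where K = 1])
      (simp_all add: linear_add[OF lin] linear_scale[OF lin] norm_eq_sqrt_inner iso)
  moreover have "cinner (A f) (A g) = cinner f g" for f g
    by (simp add: cinner_eq iso flip: J)
  ultimately show ?thesis
    using assms by (simp add: unitary_op_def bounded_opI)
qed

lemma unitary_opD:
  assumes "unitary_op A"
  shows "bounded_op A" "linear A" "bounded_linear A" "surj A" "inj A"
    "A (J f) = J (A f)" "cinner (A f) (A g) = cinner f g"
    "inner (A f) (A g) = inner f g"
  using assms bounded_opD unitary_op_inj by (auto simp: unitary_op_def inner_L2_def)

lemma unitary_op_inv_adjoint:
  assumes "unitary_op A"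
  shows "inner (A f) g = inner f (inv A g)"
  using unitary_opD(8)[OF assms, of f "inv A g"] surj_f_inv_f[OF unitary_opD(4)[OF assms], of g] by simp

lemma unitary_op_comp:
  assumes "unitary_op A" "unitary_op B"
  shows "unitary_op (A \<circ> B)"
  using unitary_opD[OF assms(1)] unitary_opD[OF assms(2)]
  by (intro unitary_opI) (simp_all add: linear_compose comp_surj del: comp_apply, simp_all)

lemma unitary_op_pow: "unitary_op A \<Longrightarrow> unitary_op (A ^^ n)"
proof (induction n)
  case 0
  show ?case by (rule unitary_opI) (simp_all add: linear_id[unfolded id_def] id_def)
next
  case (Suc n)
  then show ?case using unitary_op_comp[of A "A ^^ n"] by (simp add: comp_def)
qed

section \<open>Wavelets and their core spaces\<close>

lemma unitary_op_wavelet_system: "unitary_op (wavelet_fn j n)"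
  by (rule unitary_op_wavelet_fn[OF refl, where Q = "\<lambda>f. wavelet_fn 0 (- n) (wavelet_fn (- j) 0 f)"])
    (simp add: wavelet_fn_split[of j n, symmetric] wavelet_fn_translations wavelet_fn_dilations wavelet_fn_0_0)

text \<open>Translations permute the wavelet functions of every nonnegative scale, because \<open>2\<^sup>j m\<close> is an integer
for \<open>j \<ge> 0\<close>.\<close>

lemma translate_wavelet_fn:
  assumes "0 \<le> j"
  shows "wavelet_fn 0 m (wavelet_fn j n f) = wavelet_fn j (n + 2 ^ nat j * m) f"
  using assms
proof transfer
  fix m j n :: int and f :: "real \<Rightarrow> complex"
  assume j: "0 \<le> j" and f: "L2_rel f f"
  have "2 powr real_of_int j = of_int (2 ^ nat j)"
    using j by (simp flip: powr_realpow)
  then have "2 powr real_of_int j * (x + of_int m) + of_int n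
      = 2 powr of_int j * x + of_int (n + 2 ^ nat j * m)" for x
    by (simp add: algebra_simps)
  then have "(\<lambda>x. complex_of_real (2 powr (of_int 0 / 2)) * (complex_of_real (2 powr (of_int j / 2)) *
        f (2 powr of_int j * (2 powr of_int 0 * x + of_int m) + of_int n)))
     = (\<lambda>x. complex_of_real (2 powr (of_int j / 2)) *
        f (2 powr of_int j * x + of_int (n + 2 ^ nat j * m)))"
    by (simp del: of_int_add of_int_mult)
  with L2_rel_wavelet_fn[OF f refl, of j "n + 2 ^ nat j * m"]
  show "L2_rel
     (\<lambda>x. complex_of_real (2 powr (of_int 0 / 2)) * (complex_of_real (2 powr (of_int j / 2)) *
        f (2 powr of_int j * (2 powr of_int 0 * x + of_int m) + of_int n)))
     (\<lambda>x. complex_of_real (2 powr (of_int j / 2)) *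
        f (2 powr of_int j * x + of_int (n + 2 ^ nat j * m)))"
    by (simp only:)
qed

lemma translation_adjoint: "cinner (wavelet_fn 0 m f) g = cinner f (wavelet_fn 0 (- m) g)"
  using cinner_wavelet_fn[of 0 m f "wavelet_fn 0 (- m) g"]
  by (simp add: wavelet_fn_translations wavelet_fn_0_0)

definition nonneg_scales_perp :: "L2 \<Rightarrow> L2 set" where
  "nonneg_scales_perp \<eta> = {f. \<forall>j\<ge>0. \<forall>n. cinner f (wavelet_fn j n \<eta>) = 0}"

lemma closed_perp: "closed {f. cinner f g = 0}"
proof -
  have "{f. cinner f g = 0} = {f. inner f g = 0} \<inter> {f. inner (J f) g = 0}"
    by (auto simp: cinner_eq complex_eq_iff)
  moreover have "continuous_on UNIV J"
    by (rule bounded_linear.continuous_on[OF bounded_linear_J continuous_on_id])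
  ultimately show ?thesis
    by (simp only:) (intro closed_Int closed_Collect_eq continuous_intros)
qed

lemma cinner_zero_left: "cinner 0 g = 0"
  using cinner_scaleC_left[of 0 0 g] by simp

lemma csubspace_perp: "L2.subspace {f. cinner f g = 0}"
  by (simp add: L2.subspace_def cinner_zero_left cinner_add_left cinner_scaleC_left)

lemma closure_cspan_perp:
  assumes "\<And>b. b \<in> B \<Longrightarrow> cinner b g = 0" "f \<in> closure (cspan B)"
  shows "cinner f g = 0"
proof -
  have "cspan B \<subseteq> {f. cinner f g = 0}"
    by (rule L2.span_minimal) (use assms csubspace_perp in auto)
  then have "closure (cspan B) \<subseteq> {f. cinner f g = 0}"
    by (rule closure_minimal[OF _ closed_perp])
  then show ?thesis using assms by blast
qed

lemma core_space_alt: "core_space \<eta> = closure (cspan {wavelet_fn j n \<eta> | j n. j < 0})"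
  by (simp add: core_space_def op_powi_D_T)

lemma closed_core_space: "closed (core_space \<eta>)"
  by (simp add: core_space_def)

lemma J_core_space: "f \<in> core_space \<eta> \<Longrightarrow> J f \<in> core_space \<eta>"
proof -
  have "J ` closure (cspan B) \<subseteq> closure (cspan B)" for B
    by (rule image_closure_subset)
      (auto intro!: bounded_linear.continuous_on[OF bounded_linear_J] continuous_on_id
        intro: L2.span_scale subsetD[OF closure_subset])
  then show "f \<in> core_space \<eta> \<Longrightarrow> J f \<in> core_space \<eta>"
    unfolding core_space_def by blast
qed

lemma subspace_core_space: "subspace (core_space \<eta>)"
proof -
  have "subspace (cspan B)" for B
    by (simp add: subspace_def L2.span_zero L2.span_add scaleR_L2_def L2.span_scale)
  then show ?thesis
    unfolding core_space_def by (rule subspace_closure)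
qed

text \<open>The wavelet functions of negative scale and those of nonnegative scale together are complete, so
the closed spans of these two families are orthogonal complements. The right-hand side is visibly
invariant under all translations, which the definition by negative scales does not show.\<close>

lemma core_space_eq_nonneg_scales_perp:
  assumes "wavelet \<eta>"
  shows "core_space \<eta> = nonneg_scales_perp \<eta>"
proof
  have orth: "cinner (wavelet_fn j n \<eta>) (wavelet_fn j' n' \<eta>) = 0" if "j \<noteq> j'" for j n j' n'
    using assms that by (auto simp: wavelet_def orthonormal_basis_def)
  have dense: "closure (cspan (range (\<lambda>(j, n). wavelet_fn j n \<eta>))) = UNIV"
    using assms by (simp add: wavelet_def orthonormal_basis_def)
  show sub: "core_space \<eta> \<subseteq> nonneg_scales_perp \<eta>"
  proof
    fix f assume f: "f \<in> core_space \<eta>"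
    have "cinner f (wavelet_fn j n \<eta>) = 0" if "0 \<le> j" for j n
      by (rule closure_cspan_perp[OF _ f[unfolded core_space_alt]]) (use orth that in auto)
    then show "f \<in> nonneg_scales_perp \<eta>"
      by (simp add: nonneg_scales_perp_def)
  qed
  show "nonneg_scales_perp \<eta> \<subseteq> core_space \<eta>"
  proof
    fix f assume f: "f \<in> nonneg_scales_perp \<eta>"
    define p where "p = orth_proj (core_space \<eta>) f"
    have p: "p \<in> core_space \<eta>"
      unfolding p_def by (intro orth_proj_in subspace_core_space closed_core_space)
    have "cinner (f - p) k = 0" if "k \<in> core_space \<eta>" for k
    proof -
      have "inner (f - p) k = 0" "inner (f - p) (J k) = 0"
        unfolding p_def
        by (intro orth_proj_orth subspace_core_space closed_core_space that J_core_space)+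
      then show ?thesis by (simp add: cinner_eq J_skew complex_eq_iff)
    qed
    moreover have "wavelet_fn j n \<eta> \<in> core_space \<eta>" if "j < 0" for j n
      unfolding core_space_alt using that by (intro subsetD[OF closure_subset] L2.span_base) auto
    moreover have "cinner (f - p) (wavelet_fn j n \<eta>) = 0" if "0 \<le> j" for j n
    proof -
      have "cinner f (wavelet_fn j n \<eta>) = 0" "cinner p (wavelet_fn j n \<eta>) = 0"
        using f p sub that by (auto simp: nonneg_scales_perp_def)
      then show ?thesis
        using cinner_add_left[of "f - p" p "wavelet_fn j n \<eta>"] by simp
    qed
    ultimately have "cinner (f - p) (wavelet_fn j n \<eta>) = 0" for j n
      by (cases "j < 0") simp_all
    then have "cinner (wavelet_fn j n \<eta>) (f - p) = 0" for j n
      by (metis cinner_cnj complex_cnj_zero)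
    then have "b \<in> range (\<lambda>(j, n). wavelet_fn j n \<eta>) \<Longrightarrow> cinner b (f - p) = 0" for b
      by auto
    from closure_cspan_perp[OF this, of _ "f - p"] have "cinner (f - p) (f - p) = 0"
      by (simp add: dense)
    then have "inner (f - p) (f - p) = 0"
      by (simp add: inner_L2_def)
    then show "f \<in> core_space \<eta>"
      using p by simp
  qed
qed

lemma translation_core_space:
  assumes "wavelet \<eta>" "f \<in> core_space \<eta>"
  shows "wavelet_fn 0 m f \<in> core_space \<eta>"
  using assms
  by (simp add: core_space_eq_nonneg_scales_perp nonneg_scales_perp_def translation_adjoint translate_wavelet_fn)

text \<open>Membership in the local commutant at \<open>\<eta>\<close>, apart from boundedness, in terms of \<open>wavelet_fn\<close>.\<close>

definition locally_commutes :: "(L2 \<Rightarrow> L2) \<Rightarrow> L2 \<Rightarrow> bool" where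
  "locally_commutes X \<eta> \<longleftrightarrow> (\<forall>j n. X (wavelet_fn j n \<eta>) = wavelet_fn j n (X \<eta>))"

lemma wavelet_unitary_image:
  assumes X: "unitary_op X" and "locally_commutes X \<eta>" "wavelet \<eta>"
  shows "wavelet (X \<eta>)"
proof -
  have eq: "wavelet_fn j n (X \<eta>) = X (wavelet_fn j n \<eta>)" for j n
    using assms by (simp add: locally_commutes_def)
  define B where "B = range (\<lambda>(j, n). wavelet_fn j n \<eta>)"
  have dense: "closure (cspan B) = UNIV"
    using \<open>wavelet \<eta>\<close> by (simp add: wavelet_def orthonormal_basis_def B_def)
  have "range (\<lambda>(j, n). wavelet_fn j n (X \<eta>)) = X ` B"
    by (simp add: B_def eq image_image split_beta)
  moreover have "closure (cspan (X ` B)) = UNIV"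
  proof -
    have "X f \<in> cspan (X ` B)" if "f \<in> cspan B" for f
      using that
    proof (induction rule: L2.span_induct_alt)
      case base
      then show ?case by (simp add: linear_0[OF unitary_opD(2)[OF X]] L2.span_zero)
    next
      case (step c x y)
      then show ?case
        by (simp add: linear_add[OF unitary_opD(2)[OF X]] bounded_opD(3)[OF unitary_opD(1)[OF X]]
            L2.span_add L2.span_scale L2.span_base)
    qed
    then have "X ` closure (cspan B) \<subseteq> closure (cspan (X ` B))"
      by (intro image_closure_subset)
        (auto intro!: bounded_linear.continuous_on[OF unitary_opD(3)[OF X]] continuous_on_id
          intro: subsetD[OF closure_subset])
    then show ?thesis
      using unitary_opD(4)[OF X] dense by auto
  qed
  ultimately show ?thesis
    using \<open>wavelet \<eta>\<close> unitary_opD(7)[OF X]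
    by (simp add: wavelet_def orthonormal_basis_def eq split_beta)
qed

lemma core_space_unitary_image:
  assumes X: "unitary_op X" and comm: "locally_commutes X \<eta>" and "wavelet \<eta>"
  shows "core_space (X \<eta>) = X ` core_space \<eta>"
proof -
  have "X f \<in> nonneg_scales_perp (X \<eta>) \<longleftrightarrow> f \<in> nonneg_scales_perp \<eta>" for f
    using comm unitary_opD(7)[OF X]
    by (simp add: nonneg_scales_perp_def locally_commutes_def) metis
  then have "X ` nonneg_scales_perp \<eta> = nonneg_scales_perp (X \<eta>)"
    using unitary_opD(4)[OF X] by (auto simp: surj_def image_iff) metis
  then show ?thesis
    using assms wavelet_unitary_image[OF assms] by (simp add: core_space_eq_nonneg_scales_perp)
qed

text \<open>If \<open>W f\<close>, for \<open>f\<close> in the core space of \<open>\<eta>\<close>, were orthogonal to that space, then it would be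
orthogonal to \<open>f\<close>, so \<open>f = 0\<close>; likewise if \<open>f\<close> were orthogonal to the image of the space under
\<open>W\<close>. So the two core spaces are in generic position. Both of them reduce the translations and the
multiplication by \<open>\<i>\<close>, and the isometry between them commutes with these.\<close>

lemma core_equivalent_of_numerical_range:
  assumes \<eta>: "wavelet \<eta>" and \<zeta>: "wavelet \<zeta>"
    and W: "unitary_op W" and image: "core_space \<zeta> = W ` core_space \<eta>"
    and num: "\<And>f. \<lbrakk>inner (W f) f = 0; inner (J (W f)) f = 0\<rbrakk> \<Longrightarrow> f = 0"
  shows "core_equivalent \<zeta> \<eta>"
proof -
  let ?K = "core_space \<zeta>" and ?L = "core_space \<eta>"
  have KL: "f = 0" if "f \<in> ?K" "\<And>g. g \<in> ?L \<Longrightarrow> inner f g = 0" for f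
  proof -
    obtain h where h: "h \<in> ?L" "f = W h"
      using \<open>f \<in> ?K\<close> image by blast
    have "inner (W h) h = 0" "inner (J (W h)) h = 0"
      using that(2)[OF h(1)] that(2)[OF J_core_space[OF h(1)]] by (simp_all add: h J_skew)
    then have "h = 0" by (rule num)
    then show ?thesis
      by (simp add: h linear_0[OF unitary_opD(2)[OF W]])
  qed
  have LK: "f = 0" if "f \<in> ?L" "\<And>g. g \<in> ?K \<Longrightarrow> inner f g = 0" for f
  proof (rule num)
    have "W f \<in> ?K" using that image by blast
    then show "inner (W f) f = 0" "inner (J (W f)) f = 0"
      using that(2)[of "W f"] that(2)[of "J (W f)"] J_core_space[of "W f" \<zeta>] by (simp_all add: inner_commute)
  qed
  obtain Z where Z: "linear Z" "Z ` ?K = ?L" "\<And>f. f \<in> ?K \<Longrightarrow> norm (Z f) = norm f"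
    and comm: "\<forall>G f. reduces ?K G \<and> reduces ?L G \<longrightarrow> Z (G f) = G (Z f)"
  proof (rule generic_position_isometry[OF subspace_core_space[of \<zeta>] closed_core_space[of \<zeta>]
        subspace_core_space[of \<eta>] closed_core_space[of \<eta>]])
    show "f = 0" if "f \<in> ?K" "\<And>g. g \<in> ?L \<Longrightarrow> inner f g = 0" for f
      by (rule KL[OF that(1)]) (rule that(2))
    show "f = 0" if "f \<in> ?L" "\<And>g. g \<in> ?K \<Longrightarrow> inner f g = 0" for f
      by (rule LK[OF that(1)]) (rule that(2))
  qed blast
  have "reduces (core_space \<theta>) J" for \<theta>
    unfolding reduces_def
    using J_core_space subspace_neg[OF subspace_core_space]
    by (auto simp: bounded_linear_J J_skew intro!: exI[of _ "\<lambda>f. - J f"])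
  then have ZJ: "Z (J f) = J (Z f)" for f
    using comm by simp
  have "reduces (core_space \<theta>) (wavelet_fn 0 m)" if "wavelet \<theta>" for \<theta> m
    unfolding reduces_def
    using translation_core_space[OF that] unitary_opD(3)[OF unitary_op_wavelet_system]
    by (auto simp: inner_L2_def translation_adjoint intro!: exI[of _ "wavelet_fn 0 (- m)"])
  then have ZT: "Z (wavelet_fn 0 m f) = wavelet_fn 0 m (Z f)" for m f
    using comm \<eta> \<zeta> by simp
  have inner: "inner (Z f) (Z g) = inner f g" if "f \<in> ?K" "g \<in> ?K" for f g
  proof -
    have "norm (Z f + Z g) = norm (f + g)"
      using Z(3)[OF subspace_add[OF subspace_core_space that]] by (simp add: linear_add[OF Z(1)])
    then have "(norm (Z f + Z g))\<^sup>2 = (norm (f + g))\<^sup>2" by simp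
    moreover have "(norm (Z f))\<^sup>2 = (norm f)\<^sup>2" "(norm (Z g))\<^sup>2 = (norm g)\<^sup>2"
      using Z(3) that by simp_all
    ultimately show ?thesis
      unfolding power2_norm_eq_inner by (simp add: inner_add_left inner_add_right inner_commute)
  qed
  have "unitary_between ?K ?L Z"
    unfolding unitary_between_def
  proof (intro conjI ballI allI)
    fix f g assume fg: "f \<in> ?K" "g \<in> ?K"
    show "cinner (Z f) (Z g) = cinner f g"
      using inner[OF fg] inner[OF J_core_space[OF fg(1)] fg(2)] by (simp add: cinner_eq ZJ)
  next
    show "Z (c *\<^sub>C f) = c *\<^sub>C Z f" for c f
      unfolding scaleC_decompose[of c]
      by (simp only: linear_add[OF Z(1)] linear_scale[OF Z(1)] ZJ)
  qed (simp_all add: Z linear_add[OF Z(1)])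
  moreover have "Z (core_rep \<zeta> l f) = core_rep \<eta> l (Z f)" if "f \<in> ?K" for l f
    using that Z(2) by (auto simp: core_rep_def op_powi_T ZT)
  ultimately show ?thesis
    using \<eta> \<zeta> by (auto simp: core_equivalent_def)
qed

lemma core_equivalent_trans:
  assumes "core_equivalent \<phi> \<theta>" "core_equivalent \<theta> \<psi>"
  shows "core_equivalent \<phi> \<psi>"
proof -
  obtain A B where A: "unitary_between (core_space \<phi>) (core_space \<theta>) A"
      "\<And>l f. f \<in> core_space \<phi> \<Longrightarrow> A (core_rep \<phi> l f) = core_rep \<theta> l (A f)"
    and B: "unitary_between (core_space \<theta>) (core_space \<psi>) B"
      "\<And>l f. f \<in> core_space \<theta> \<Longrightarrow> B (core_rep \<theta> l f) = core_rep \<psi> l (B f)"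
    using assms unfolding core_equivalent_def by metis
  have AK: "A f \<in> core_space \<theta>" if "f \<in> core_space \<phi>" for f
    using A(1) that unfolding unitary_between_def by blast
  have "unitary_between (core_space \<phi>) (core_space \<psi>) (B \<circ> A)"
    using A(1) B(1) AK by (simp add: unitary_between_def flip: image_image[of B A])
  moreover have "(B \<circ> A) (core_rep \<phi> l f) = core_rep \<psi> l ((B \<circ> A) f)" if "f \<in> core_space \<phi>" for l f
    using that by (simp add: A B AK)
  ultimately show ?thesis
    using assms unfolding core_equivalent_def by blast
qed

section \<open>Unitaries in an algebra of locally commuting operators\<close>

locale operator_algebra =
  fixes \<A> :: "('a \<Rightarrow> 'a::real_vector) set"
  assumes ident: "(\<lambda>x. x) \<in> \<A>"
    and comp: "X \<in> \<A> \<Longrightarrow> Y \<in> \<A> \<Longrightarrow> (\<lambda>x. X (Y x)) \<in> \<A>"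
    and add: "X \<in> \<A> \<Longrightarrow> Y \<in> \<A> \<Longrightarrow> (\<lambda>x. X x + Y x) \<in> \<A>"
    and scale: "X \<in> \<A> \<Longrightarrow> (\<lambda>x. r *\<^sub>R X x) \<in> \<A>"
begin

lemma diff: "X \<in> \<A> \<Longrightarrow> Y \<in> \<A> \<Longrightarrow> (\<lambda>x. X x - Y x) \<in> \<A>"
  using add[OF _ scale[of Y "- 1"], of X] by simp

lemma sum: "finite I \<Longrightarrow> (\<And>i. i \<in> I \<Longrightarrow> X i \<in> \<A>) \<Longrightarrow> (\<lambda>x. \<Sum>i\<in>I. X i x) \<in> \<A>"
proof (induction rule: finite_induct)
  case empty
  then show ?case using scale[OF ident, of 0] by simp
next
  case (insert i I)
  then show ?case by (simp add: add)
qed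

lemma polar_approx:
  assumes R: "R \<in> \<A>" and S: "S \<in> \<A>"
  shows "polar_approx R S N \<in> \<A>"
proof -
  have X: "defect R S \<in> \<A>"
    unfolding defect_def[abs_def] by (rule diff[OF ident comp[OF S R]])
  have pow: "(\<lambda>x. (defect R S ^^ n) x) \<in> \<A>" for n
  proof (induction n)
    case (Suc n)
    from comp[OF X Suc] show ?case by simp
  qed (simp add: ident)
  show ?thesis
    unfolding polar_approx_def[abs_def] by (rule sum[OF finite_lessThan scale[OF comp[OF R pow]]])
qed

end

text \<open>The approximations of the square root are polynomials in \<open>V\<close>, \<open>V'\<close> and \<open>J\<close>.\<close>

lemma (in unitary_with_complex_structure) usqrt_approx_in_algebra:
  assumes "operator_algebra \<A>" "V \<in> \<A>" "V' \<in> \<A>" "J \<in> \<A>"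
  shows "usqrt_approx N \<in> \<A>"
proof -
  interpret operator_algebra \<A> by (fact assms)
  have RS: "R \<in> \<A>" "S \<in> \<A>"
    unfolding R_def[abs_def] S_def[abs_def] by (rule scale[OF add[OF ident assms(2)]], rule scale[OF add[OF ident assms(3)]])
  show ?thesis
    unfolding usqrt_approx_def[abs_def]
    by (rule add[OF polar_approx[OF RS]
          comp[OF \<open>J \<in> \<A>\<close> diff[OF ident comp[OF polar_approx[OF RS(2,1)] polar_approx[OF RS]]]]])
qed

lemma locally_commutes_limit:
  assumes "\<And>N. locally_commutes (W N) \<eta>" "\<And>f. (\<lambda>N. W N f) \<longlonglongrightarrow> X f"
  shows "locally_commutes X \<eta>"
  unfolding locally_commutes_def
proof (intro allI)
  fix j n
  have "bounded_linear (wavelet_fn j n)"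
    by (rule unitary_opD(3)[OF unitary_op_wavelet_system])
  from bounded_linear.tendsto[OF this assms(2)[of \<eta>]]
  have "(\<lambda>N. W N (wavelet_fn j n \<eta>)) \<longlonglongrightarrow> wavelet_fn j n (X \<eta>)"
    using assms(1) by (simp add: locally_commutes_def)
  then show "X (wavelet_fn j n \<eta>) = wavelet_fn j n (X \<eta>)"
    by (rule LIMSEQ_unique[OF assms(2)])
qed

text \<open>The square root \<open>W\<close> of \<open>V\<close> gives an intermediate wavelet \<open>W \<eta>\<close>. Its square is \<open>V\<close>, so it carries
the core space of \<open>\<eta>\<close> to that of \<open>W \<eta>\<close> and the latter to that of \<open>V \<eta>\<close>. In both
steps the property of its numerical range applies. The operator \<open>W\<close> itself need not belong to the
algebra; being a strong limit of its elements is enough for the local commutation at \<open>\<eta>\<close>.\<close>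

lemma core_equivalent_unitary_in_algebra:
  assumes "operator_algebra \<A>" and J: "J \<in> \<A>"
    and comm: "\<And>X. X \<in> \<A> \<Longrightarrow> locally_commutes X \<eta>"
    and V: "V \<in> \<A>" "inv V \<in> \<A>" "unitary_op V"
    and \<eta>: "wavelet \<eta>"
  shows "core_equivalent (V \<eta>) \<eta>"
proof -
  note lin = unitary_opD(2)[OF V(3)] and bij = unitary_opD(4,5)[OF V(3)]
  have VV: "V (inv V f) = f" "inv V (V f) = f" for f
    using bij by (simp_all add: surj_f_inv_f)
  interpret unitary_with_complex_structure V "inv V" J
  proof (rule unitary_with_complex_structure.intro)
    show "linear V" by (rule lin)
    show "linear (inv V)"
    proof (rule linearI)
      show "inv V (f + g) = inv V f + inv V g" for f g
        by (rule injD[OF bij(2)]) (simp add: VV linear_add[OF lin])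
      show "inv V (r *\<^sub>R f) = r *\<^sub>R inv V f" for r f
        by (rule injD[OF bij(2)]) (simp add: VV linear_scale[OF lin])
    qed
    show "J (V f) = V (J f)" for f
      by (rule unitary_opD(6)[OF V(3), symmetric])
  qed (simp_all only: VV linear_J J_J J_isometric unitary_op_inv_adjoint[OF V(3)])
  define W where "W = usqrt"
  have WW: "W (W f) = V f" for f
    by (simp add: W_def usqrt_usqrt)
  have "locally_commutes W \<eta>"
    unfolding W_def
    by (rule locally_commutes_limit[OF _ LIMSEQ_usqrt])
      (rule comm[OF usqrt_approx_in_algebra[OF assms(1) V(1,2) J]])
  moreover have W: "unitary_op W"
  proof (rule unitary_opI)
    show "linear W" "inner (W f) (W g) = inner f g" for f g
      by (simp_all add: W_def linear_usqrt usqrt_isometric)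
    show "W (J f) = J (W f)" for f
      by (simp add: W_def usqrt_def linear_add[OF linear_J] J_Z J_E del: L2.scale_scale)
    show "surj W"
      by (rule surjI[where f = "\<lambda>f. W (inv V f)"]) (simp add: WW VV)
  qed
  ultimately have W\<eta>: "wavelet (W \<eta>)" and core_W: "core_space (W \<eta>) = W ` core_space \<eta>"
    using wavelet_unitary_image core_space_unitary_image \<eta> by blast+
  have num: "f = 0" if "inner (W f) f = 0" "inner (J (W f)) f = 0" for f
    using that unfolding W_def by (rule usqrt_numerical_range)
  have V\<eta>: "wavelet (V \<eta>)"
    using wavelet_unitary_image comm V \<eta> by blast
  have "core_space (V \<eta>) = V ` core_space \<eta>"
    using core_space_unitary_image comm V \<eta> by blast
  also have "\<dots> = W ` core_space (W \<eta>)"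
    by (simp add: core_W image_image WW)
  finally have core_V: "core_space (V \<eta>) = W ` core_space (W \<eta>)" .
  have "core_equivalent (V \<eta>) (W \<eta>)"
    by (rule core_equivalent_of_numerical_range[OF W\<eta> V\<eta> W core_V num])
  moreover have "core_equivalent (W \<eta>) \<eta>"
    by (rule core_equivalent_of_numerical_range[OF \<eta> W\<eta> W core_W num])
  ultimately show ?thesis
    by (rule core_equivalent_trans)
qed

section \<open>The commutant of dilation and translation\<close>

lemma commutantD:
  assumes "A \<in> commutant {D, T}"
  shows "bounded_op A" "A (wavelet_fn j n f) = wavelet_fn j n (A f)"
proof -
  show "bounded_op A"
    using assms by (simp add: commutant_def)
  have powi: "A (op_powi B m g) = op_powi B m (A g)" if "A \<circ> B = B \<circ> A" "unitary_op B" for B m g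
  proof -
    have 1: "A (B g) = B (A g)" for g
      using fun_cong[OF that(1), of g] by simp
    have 2: "A (inv B g) = inv B (A g)" for g
    proof (rule injD[OF unitary_opD(5)[OF that(2)]])
      show "B (A (inv B g)) = B (inv B (A g))"
        using unitary_opD(4)[OF that(2)] by (simp add: surj_f_inv_f flip: 1)
    qed
    have pow: "A ((C ^^ i) g) = (C ^^ i) (A g)" if "\<And>g. A (C g) = C (A g)" for C i g
      using that by (induction i) simp_all
    show ?thesis
      by (simp add: op_powi_def pow[of B, OF 1] pow[of "inv B", OF 2])
  qed
  have "A \<circ> D = D \<circ> A" "A \<circ> T = T \<circ> A"
    using assms by (simp_all add: commutant_def)
  then show "A (wavelet_fn j n f) = wavelet_fn j n (A f)"
    by (simp add: powi unitary_op_D unitary_op_T flip: op_powi_D_T)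
qed

lemma commutantI:
  assumes "bounded_op A" "\<And>f. A (D f) = D (A f)" "\<And>f. A (T f) = T (A f)"
  shows "A \<in> commutant {D, T}"
  using assms by (auto simp: commutant_def)

lemma commutant_D:
  assumes "A \<in> commutant {D, T}"
  shows "A (D f) = D (A f)"
proof -
  have "A \<circ> D = D \<circ> A"
    using assms by (simp add: commutant_def)
  from fun_cong[OF this, of f] show ?thesis by simp
qed

lemma commutant_T:
  assumes "A \<in> commutant {D, T}"
  shows "A (T f) = T (A f)"
proof -
  have "A \<circ> T = T \<circ> A"
    using assms by (simp add: commutant_def)
  from fun_cong[OF this, of f] show ?thesis by simp
qed

lemma bounded_op_comp: "bounded_op A \<Longrightarrow> bounded_op B \<Longrightarrow> bounded_op (\<lambda>f. A (B f))"
  by (simp add: bounded_op_def bounded_linear_compose)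

lemma commutant_comp:
  assumes "A \<in> commutant {D, T}" "B \<in> commutant {D, T}"
  shows "(\<lambda>f. A (B f)) \<in> commutant {D, T}"
  by (intro commutantI)
    (simp_all add: bounded_op_comp commutantD(1) assms commutant_D[OF assms(1)] commutant_D[OF assms(2)]
      commutant_T[OF assms(1)] commutant_T[OF assms(2)])

lemma scaleC_in_commutant: "(\<lambda>f. c *\<^sub>C f) \<in> commutant {D, T}"
proof (rule commutantI)
  show "bounded_op (\<lambda>f. c *\<^sub>C f)"
  proof (rule bounded_opI)
    show "bounded_linear (\<lambda>f. c *\<^sub>C f)"
      unfolding scaleC_decompose[of c]
      by (intro bounded_linear_add bounded_linear_scaleR_right bounded_linear_ident
          bounded_linear_compose[OF bounded_linear_scaleR_right bounded_linear_J])
  qed (simp add: mult.commute)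
qed (simp_all add: bounded_opD(3)[OF unitary_opD(1)[OF unitary_op_D]] bounded_opD(3)[OF unitary_opD(1)[OF unitary_op_T]])

text \<open>\<open>D\<close> and \<open>T\<close> are unitary, so commuting with one of them is the same as commuting with its
adjoint, and this passes to the adjoint of \<open>A\<close>.\<close>

lemma commutant_adjoint:
  assumes A: "A \<in> commutant {D, T}"
  shows "\<exists>B\<in>commutant {D, T}. \<forall>f g. inner (A f) g = inner f (B g)"
proof -
  have Ab: "bounded_linear A" and AJ: "A (J f) = J (A f)" for f
    using bounded_opD[OF commutantD(1)[OF A]] by simp_all
  obtain B where B: "\<And>f g. inner (A f) g = inner f (B g)"
    using adjoint_exists[OF Ab] by blast
  have eqI: "x = y" if "\<And>f. inner f x = inner f y" for x y :: L2
    using that vector_eq_ldot by blast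
  have "B \<in> commutant {D, T}"
  proof (rule commutantI)
    show "bounded_op B"
    proof (rule bounded_opI)
      show "bounded_linear B"
      proof (rule bounded_linear_intro[where K = "onorm A"])
        show "B (x + y) = B x + B y" for x y
          by (rule eqI) (simp add: inner_add_right flip: B)
        show "B (r *\<^sub>R x) = r *\<^sub>R B x" for r x
          by (rule eqI) (simp flip: B)
        show "norm (B x) \<le> norm x * onorm A" for x
        proof -
          have "norm (B x) * norm (B x) = inner (A (B x)) x"
            by (simp add: B flip: power2_norm_eq_inner power2_eq_square)
          also have "\<dots> \<le> norm (A (B x)) * norm x"
            by (rule norm_cauchy_schwarz)
          also have "\<dots> \<le> (onorm A * norm (B x)) * norm x"
            by (intro mult_right_mono onorm[OF Ab]) simp
          finally show ?thesis
            using onorm_pos_le[OF Ab]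
            by (cases "norm (B x) = 0") (auto simp: mult_ac mult_le_cancel_left)
        qed
      qed
      have "inner f (B (J g)) = inner f (J (B g))" for f g
      proof -
        have "inner f (B (J g)) = - inner (J (A f)) g"
          by (simp add: J_skew flip: B)
        also have "\<dots> = - inner (J f) (B g)"
          by (simp add: AJ[symmetric] B)
        finally show ?thesis
          by (simp add: J_skew)
      qed
      then show "B (J f) = J (B f)" for f
        by (intro eqI)
    qed
    have "B (P g) = P (B g)" if P: "unitary_op P" and AP: "\<And>f. A (P f) = P (A f)" for P g
    proof (rule eqI)
      fix f
      have f: "f = P (inv P f)"
        using unitary_opD(4)[OF P] by (simp add: surj_f_inv_f)
      have "inner f (B (P g)) = inner (P (A (inv P f))) (P g)"
        by (subst f) (simp add: AP flip: B)
      also have "\<dots> = inner (inv P f) (B g)"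
        by (simp add: unitary_opD(8)[OF P] B)
      also have "\<dots> = inner (P (inv P f)) (P (B g))"
        by (simp only: unitary_opD(8)[OF P])
      finally show "inner f (B (P g)) = inner f (P (B g))"
        by (simp flip: f)
    qed
    then show "B (D f) = D (B f)" "B (T f) = T (B f)" for f
      by (simp_all add: unitary_op_D unitary_op_T commutant_D[OF A] commutant_T[OF A])
  qed
  with B show ?thesis by blast
qed

section \<open>The interpolation algebra\<close>

inductive_set interpolation_algebra :: "(L2 \<Rightarrow> L2) \<Rightarrow> (L2 \<Rightarrow> L2) set" for U where
  monomial: "A \<in> commutant {D, T} \<Longrightarrow> (\<lambda>f. A ((U ^^ j) f)) \<in> interpolation_algebra U"
| add: "X \<in> interpolation_algebra U \<Longrightarrow> Y \<in> interpolation_algebra U \<Longrightarrow>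
    (\<lambda>f. X f + Y f) \<in> interpolation_algebra U"

context
  fixes \<psi> :: L2 and U :: "L2 \<Rightarrow> L2" and k :: nat
  assumes admits: "admits_operator_interpolation \<psi> U k"
begin

lemma unitary_U: "unitary_op U"
  using admits by (simp add: admits_operator_interpolation_def)

lemma linear_U_pow: "linear (U ^^ j)"
  by (intro unitary_opD(2) unitary_op_pow unitary_U)

lemma U_pow_period: "(U ^^ (k * j)) f = f"
proof -
  have "(U ^^ k) = id"
    using admits by (simp add: admits_operator_interpolation_def)
  then show ?thesis
    by (simp add: funpow_mult[symmetric] id_def) (induction j, simp_all)
qed

text \<open>The inverse of \<open>U\<^sup>j\<close> is written as the power with the natural exponent \<open>(k - 1) j\<close>, so that it is
visibly in the algebra.\<close>

lemma U_pow_pred: "(U ^^ j) ((U ^^ ((k - Suc 0) * j)) f) = f"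
proof -
  have "j + (k - Suc 0) * j = k * j"
    using admits by (cases k) (simp_all add: admits_operator_interpolation_def)
  then show ?thesis
    using U_pow_period[of j f] funpow_add[of j "(k - Suc 0) * j" U] by simp
qed

lemma U_pow_adjoint: "inner ((U ^^ j) f) g = inner f ((U ^^ ((k - Suc 0) * j)) g)"
  using unitary_opD(8)[OF unitary_op_pow[OF unitary_U], of j f "(U ^^ ((k - Suc 0) * j)) g"]
  by (simp add: U_pow_pred)

text \<open>This is where \<open>U\<^sup>* {D, T}' U = {D, T}'\<close> enters: the inclusion of the right-hand side in the
left-hand side writes an element \<open>B\<close> of the commutant as \<open>U\<^sup>* C U\<close>, so that \<open>U B = C U\<close>.\<close>

lemma U_pow_past_commutant:
  assumes "A \<in> commutant {D, T}"
  shows "\<exists>B\<in>commutant {D, T}. \<forall>f. (U ^^ j) (A f) = B ((U ^^ j) f)"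
proof (induction j)
  case 0
  then show ?case using assms by auto
next
  case (Suc j)
  then obtain B where B: "B \<in> commutant {D, T}" "\<And>f. (U ^^ j) (A f) = B ((U ^^ j) f)"
    by blast
  have "B \<in> (\<lambda>A. adjoint_op U \<circ> A \<circ> U) ` commutant {D, T}"
    using admits B(1) by (simp add: admits_operator_interpolation_def)
  then obtain C where C: "C \<in> commutant {D, T}" "B = inv U \<circ> C \<circ> U"
    by (auto simp: unitary_op_adjoint_op[OF unitary_U])
  have "U (B f) = C (U f)" for f
    using unitary_opD(4)[OF unitary_U] by (simp add: C(2) surj_f_inv_f)
  then show ?case
    using C(1) B(2) by auto
qed

lemma interpolation_algebra_comp:
  assumes "X \<in> interpolation_algebra U" "Y \<in> interpolation_algebra U"
  shows "(\<lambda>f. X (Y f)) \<in> interpolation_algebra U"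
  using assms
proof (induction arbitrary: Y rule: interpolation_algebra.induct)
  case (monomial A i)
  have A: "A \<in> commutant {D, T}" by (rule monomial(1))
  from monomial(2) show ?case
  proof (induction rule: interpolation_algebra.induct)
    case (monomial B j)
    obtain C where C: "C \<in> commutant {D, T}" "\<And>f. (U ^^ i) (B f) = C ((U ^^ i) f)"
      using U_pow_past_commutant[OF monomial(1)] by blast
    have "(\<lambda>f. A ((U ^^ i) (B ((U ^^ j) f)))) = (\<lambda>f. A (C ((U ^^ (i + j)) f)))"
      by (simp add: C(2) funpow_add)
    then show ?case
      using interpolation_algebra.monomial[OF commutant_comp[OF A C(1)]] by simp
  next
    case (add X Y)
    note lin = linear_add[OF linear_U_pow] linear_add[OF bounded_opD(2)[OF commutantD(1)[OF A]]]
    show ?case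
      using interpolation_algebra.add[OF add.IH] by (simp add: lin)
  qed
next
  case (add X X')
  then show ?case
    using interpolation_algebra.add by blast
qed

lemma operator_algebra_interpolation: "operator_algebra (interpolation_algebra U)"
proof (rule operator_algebra.intro)
  show "(\<lambda>x. x) \<in> interpolation_algebra U"
    using interpolation_algebra.monomial[OF scaleC_in_commutant[of 1], where U = U and j = 0] by simp
  show "(\<lambda>f. r *\<^sub>R X f) \<in> interpolation_algebra U" if "X \<in> interpolation_algebra U" for r X
    using interpolation_algebra_comp[OF interpolation_algebra.monomial[OF scaleC_in_commutant[of "of_real r"], where U = U and j = 0] that]
    by (simp add: scaleR_L2_def)
qed (rule interpolation_algebra_comp interpolation_algebra.add; assumption)+

text \<open>The adjoint of \<open>A U\<^sup>j\<close> is \<open>U\<^sup>-\<^sup>j A\<^sup>*\<close>, which is again of the form \<open>C U\<^sup>-\<^sup>j\<close>.\<close>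

lemma interpolation_algebra_adjoint:
  assumes "X \<in> interpolation_algebra U"
  shows "\<exists>Y\<in>interpolation_algebra U. \<forall>f g. inner (X f) g = inner f (Y g)"
  using assms
proof (induction rule: interpolation_algebra.induct)
  case (monomial A j)
  obtain B where B: "B \<in> commutant {D, T}" "\<And>f g. inner (A f) g = inner f (B g)"
    using commutant_adjoint[OF monomial] by blast
  obtain C where C: "C \<in> commutant {D, T}" "\<And>f. (U ^^ ((k - Suc 0) * j)) (B f) = C ((U ^^ ((k - Suc 0) * j)) f)"
    using U_pow_past_commutant[OF B(1)] by blast
  have "\<forall>f g. inner (A ((U ^^ j) f)) g = inner f (C ((U ^^ ((k - Suc 0) * j)) g))"
    by (simp add: B(2) U_pow_adjoint C(2))
  then show ?case
    by (rule bexI[where x = "\<lambda>g. C ((U ^^ ((k - Suc 0) * j)) g)"])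
      (rule interpolation_algebra.monomial[OF C(1)])
next
  case (add X Y)
  then obtain X' Y' where X': "X' \<in> interpolation_algebra U" "\<And>f g. inner (X f) g = inner f (X' g)"
    and Y': "Y' \<in> interpolation_algebra U" "\<And>f g. inner (Y f) g = inner f (Y' g)"
    by blast
  show ?case
    by (rule bexI[OF _ interpolation_algebra.add[OF X'(1) Y'(1)]])
      (simp add: inner_add_left inner_add_right X' Y')
qed

lemma inv_in_interpolation_algebra:
  assumes X: "X \<in> interpolation_algebra U" "unitary_op X"
  shows "inv X \<in> interpolation_algebra U"
proof -
  obtain Y where Y: "Y \<in> interpolation_algebra U" "\<And>f g. inner (X f) g = inner f (Y g)"
    using interpolation_algebra_adjoint[OF X(1)] by blast
  have "inner f (inv X g) = inner f (Y g)" for f g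
    by (simp add: unitary_op_inv_adjoint[OF X(2)] flip: Y(2))
  then have "inv X = Y"
    using vector_eq_ldot by blast
  with Y(1) show ?thesis by simp
qed

lemma U_pow_locally_commutes: "(U ^^ i) (wavelet_fn j n \<psi>) = wavelet_fn j n ((U ^^ i) \<psi>)"
  using admits by (simp add: admits_operator_interpolation_def local_commutant_def op_powi_D_T)

text \<open>Elements of the commutant pass all dilations and translations, and \<open>U\<^sup>j\<close> passes those applied to
\<open>U\<^sup>i \<psi>\<close> because \<open>U\<^sup>j\<^sup>+\<^sup>i\<close> and \<open>U\<^sup>i\<close> pass those applied to \<open>\<psi>\<close>.\<close>

lemma interpolation_algebra_locally_commutes:
  assumes "X \<in> interpolation_algebra U"
  shows "locally_commutes X ((U ^^ i) \<psi>)"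
  using assms
proof (induction rule: interpolation_algebra.induct)
  case (monomial A j)
  have "(U ^^ j) (wavelet_fn l n ((U ^^ i) \<psi>)) = wavelet_fn l n ((U ^^ j) ((U ^^ i) \<psi>))" for l n
    using U_pow_locally_commutes[of "j + i" l n] by (simp add: funpow_add U_pow_locally_commutes)
  then show ?case
    by (simp add: locally_commutes_def commutantD(2)[OF monomial])
next
  case (add X Y)
  then show ?case
    by (simp add: locally_commutes_def linear_add[OF unitary_opD(2)[OF unitary_op_wavelet_system]])
qed

text \<open>With respect to \<open>\<eta> = U\<^sup>j \<psi>\<close> the wavelet \<open>V \<psi>\<close> is the image of \<open>\<eta>\<close> under the unitary
\<open>V U\<^sup>-\<^sup>j\<close> of the algebra.\<close>

lemma core_equivalent_interpolated:
  assumes \<psi>: "wavelet \<psi>" and V: "V \<in> interpolation_algebra U" "unitary_op V"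
  shows "core_equivalent (V \<psi>) ((U ^^ j) \<psi>)"
proof -
  interpret operator_algebra "interpolation_algebra U"
    by (rule operator_algebra_interpolation)
  define X where "X f = V ((U ^^ ((k - Suc 0) * j)) f)" for f
  have U_pow: "(U ^^ i) \<in> interpolation_algebra U" for i
    using interpolation_algebra.monomial[OF scaleC_in_commutant[of 1], where U = U and j = i] by simp
  have X: "X \<in> interpolation_algebra U"
    unfolding X_def[abs_def] by (rule comp[OF V(1) U_pow])
  have unitary_X: "unitary_op X"
    using unitary_op_comp[OF V(2) unitary_op_pow[OF unitary_U]] by (simp add: X_def[abs_def] comp_def)
  have \<eta>: "wavelet ((U ^^ j) \<psi>)"
    using wavelet_unitary_image[OF unitary_op_pow[OF unitary_U] _ \<psi>]
      interpolation_algebra_locally_commutes[OF U_pow, of j 0] by simp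
  have "(U ^^ ((k - Suc 0) * j)) ((U ^^ j) \<psi>) = \<psi>"
    using U_pow_pred[of j \<psi>] by (metis add.commute comp_apply funpow_add)
  then have "V \<psi> = X ((U ^^ j) \<psi>)"
    by (simp add: X_def)
  also have "core_equivalent \<dots> ((U ^^ j) \<psi>)"
    using interpolation_algebra.monomial[OF scaleC_in_commutant[of \<i>], where U = U and j = 0]
    by (intro core_equivalent_unitary_in_algebra[OF operator_algebra_interpolation]
        interpolation_algebra_locally_commutes X inv_in_interpolation_algebra unitary_X \<eta>) simp_all
  finally show ?thesis .
qed

end

theorem theorem4:
  fixes \<psi> \<phi> :: L2 and U V :: "L2 \<Rightarrow> L2" and A :: "nat \<Rightarrow> L2 \<Rightarrow> L2" and k :: nat
  assumes "wavelet \<psi>"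
    and "admits_operator_interpolation \<psi> U k"
    and "\<forall>j\<in>{1..k}. A j \<in> commutant {D, T}"
    and "V = (\<lambda>f. \<Sum>j=1..k. A j ((U ^^ j) f))"
    and "unitary_op V"
    and "\<phi> = V \<psi>"
  shows "\<forall>\<eta>\<in>interpolation_family \<psi> U k. core_equivalent \<phi> \<eta>"
proof -
  have "V \<in> interpolation_algebra U"
    unfolding assms(4)
    by (intro operator_algebra.sum[OF operator_algebra_interpolation[OF assms(2)]]
        interpolation_algebra.monomial) (use assms(3) in auto)
  then show ?thesis
    using core_equivalent_interpolated[OF assms(2,1) _ assms(5)]
    by (auto simp: interpolation_family_def assms(6))
qed

end
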